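(* The weighted generating series of hollow hypertrees decorated by $\widehat{\operatorname{PreLie}}$ is $$S^h_{\widehat{\operatorname{PreLie}}}=x+\sum_{n \geq 2}\bigl((x_1+\cdots + x_n)t+n\bigr)^{n-1} \frac{x^n}{n!},$$ and the weighted generating series of rooted hypertrees decorated by $\widehat{\operatorname{PreLie}}$ is $$S^r_{\widehat{\operatorname{PreLie}}}=\frac{x}{t}+\sum_{n \geq 2}(x_1+\cdots + x_n) \bigl((x_1+\cdots + x_n)t+n-1\bigr)^{n-2} \frac{x^n}{n!}.$$
   Context: A hypertree on a finite non-empty set $V$ is a pair $(V,E)$, $E$ a set of subsets of $V$ of cardinality $\ge2$ (edges), whose bipartite incidence graph (on $V\sqcup E$) is a tree. A rooted hypertree is a hypertree with a distinguished vertex (the root). A hollow hypertree on $I$ is a hypertree on $\{\#\}\sqcup I$ such that $\#$ (the gap) belongs to exactly one edge. The petiole of an edge $e$ is the vertex of $e$ nearest to the root (resp. the gap; the gap is the petiole of the edge containing it). A $\widehat{\operatorname{PreLie}}$-decorated rooted (resp. hollow) hypertree is a rooted (resp. hollow) hypertree together with, for every edge $e$, a rooted tree whose vertex set is the set of vertices of $e$ different from its petiole. Such a structure on vertex set $\{1,\dots,n\}$ (resp. $\{\#\}\sqcup\{1,\dots,n\}$) with underlying edge set $E$ is given the weight $t^{|E|-1}\prod_{i=1}^n x_i^{p(i)}$, where $p(i)$ is the number of edges whose petiole is $i$ and $t,x_1,x_2,\ldots$ are formal variables. The weighted generating series is $\sum_{n\ge1}a_n\,x^n/n!$ with $a_n$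 the sum of the weights of all structures on $n$ labelled vertices. *)

theory Defs
  imports
    "HOL-Library.FuncSet"
    "HOL-Library.Poly_Mapping"
    "HOL-Computational_Algebra.Formal_Power_Series"
begin

section \<open>Finite simple graphs and trees\<close>

definition simple_graph :: "'a set \<Rightarrow> 'a set set \<Rightarrow> bool" where
  "simple_graph V F \<longleftrightarrow> finite V \<and> (\<forall>f\<in>F. f \<subseteq> V \<and> card f = 2)"

text \<open>A walk is given by its non-empty list of vertices; its length as a walk is one less than
  the length of the list.\<close>

definition is_walk :: "'a set \<Rightarrow> 'a set set \<Rightarrow> 'a list \<Rightarrow> bool" where
  "is_walk V F p \<longleftrightarrow> p \<noteq> [] \<and> set p \<subseteq> V \<and> successively (\<lambda>u v. {u, v} \<in> F) p"

definition graph_connected :: "'a set \<Rightarrow> 'a set set \<Rightarrow> bool" where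
  "graph_connected V F \<longleftrightarrow>
     V \<noteq> {} \<and> (\<forall>u\<in>V. \<forall>v\<in>V. \<exists>p. is_walk V F p \<and> hd p = u \<and> last p = v)"

definition is_cycle :: "'a set \<Rightarrow> 'a set set \<Rightarrow> 'a list \<Rightarrow> bool" where
  "is_cycle V F p \<longleftrightarrow>
     is_walk V F p \<and> distinct p \<and> length p \<ge> 3 \<and> {last p, hd p} \<in> F"

definition is_tree :: "'a set \<Rightarrow> 'a set set \<Rightarrow> bool" where
  "is_tree V F \<longleftrightarrow> simple_graph V F \<and> graph_connected V F \<and> (\<nexists>p. is_cycle V F p)"

text \<open>Only meaningful if the two vertices are joined by a walk.\<close>

definition graph_dist :: "'a set \<Rightarrow> 'a set set \<Rightarrow> 'a \<Rightarrow> 'a \<Rightarrow> nat" where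
  "graph_dist V F u v =
     (LEAST k. \<exists>p. is_walk V F p \<and> hd p = u \<and> last p = v \<and> length p = Suc k)"

text \<open>Rooted trees with a given vertex set, as pairs of a root and a set of edges.\<close>

definition rooted_trees_on :: "'a set \<Rightarrow> ('a \<times> 'a set set) set" where
  "rooted_trees_on W = {(r, F). r \<in> W \<and> is_tree W F}"

section \<open>Hypertrees\<close>

definition incidence_vertices :: "'a set \<Rightarrow> 'a set set \<Rightarrow> ('a + 'a set) set" where
  "incidence_vertices V E = V <+> E"

definition incidence_edges :: "'a set set \<Rightarrow> ('a + 'a set) set set" where
  "incidence_edges E = {{Inl v, Inr e} |v e. e \<in> E \<and> v \<in> e}"

definition hypertree :: "'a set \<Rightarrow> 'a set set \<Rightarrow> bool" where
  "hypertree V E \<longleftrightarrow>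
     finite V \<and> V \<noteq> {} \<and> (\<forall>e\<in>E. e \<subseteq> V \<and> card e \<ge> 2) \<and>
     is_tree (incidence_vertices V E) (incidence_edges E)"

definition rooted_hypertree :: "'a set \<Rightarrow> 'a \<Rightarrow> 'a set set \<Rightarrow> bool" where
  "rooted_hypertree V r E \<longleftrightarrow> hypertree V E \<and> r \<in> V"

text \<open>In a hollow hypertree on \<open>I\<close>, the gap is \<open>None\<close> and the elements of \<open>I\<close> are embedded
  by \<open>Some\<close>.\<close>

definition hollow_vertices :: "'a set \<Rightarrow> 'a option set" where
  "hollow_vertices I = insert None (Some ` I)"

definition hollow_hypertree :: "'a set \<Rightarrow> 'a option set set \<Rightarrow> bool" where
  "hollow_hypertree I E \<longleftrightarrow> hypertree (hollow_vertices I) E \<and> (\<exists>!e. e \<in> E \<and> None \<in> e)"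

text \<open>The vertex of \<open>e\<close> nearest to \<open>r\<close>, where \<open>r\<close> is the root or the gap; distances are taken in
  the incidence graph. In a hypertree the nearest vertex is unique. If \<open>r \<in> e\<close>, it is \<open>r\<close>, which
  covers the convention for the edge containing the gap.\<close>

definition petiole :: "'a set \<Rightarrow> 'a set set \<Rightarrow> 'a \<Rightarrow> 'a set \<Rightarrow> 'a" where
  "petiole V E r e =
     arg_min_on (\<lambda>v. graph_dist (incidence_vertices V E) (incidence_edges E) (Inl r) (Inl v)) e"

definition decorations :: "'a set \<Rightarrow> 'a set set \<Rightarrow> 'a \<Rightarrow> ('a set \<Rightarrow> 'a \<times> 'a set set) set" where
  "decorations V E r = (\<Pi>\<^sub>E e\<in>E. rooted_trees_on (e - {petiole V E r e}))"

definition decorated_rooted_hypertrees ::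
    "'a set \<Rightarrow> ('a \<times> 'a set set \<times> ('a set \<Rightarrow> 'a \<times> 'a set set)) set" where
  "decorated_rooted_hypertrees V =
     {(r, E, D). rooted_hypertree V r E \<and> D \<in> decorations V E r}"

definition decorated_hollow_hypertrees ::
    "'a set \<Rightarrow> ('a option set set \<times> ('a option set \<Rightarrow> 'a option \<times> 'a option set set)) set" where
  "decorated_hollow_hypertrees I =
     {(E, D). hollow_hypertree I E \<and> D \<in> decorations (hollow_vertices I) E None}"

section \<open>Weighted generating series\<close>

text \<open>The ring of Laurent polynomials in \<open>t\<close> over the polynomial ring in \<open>x\<^sub>1, x\<^sub>2, \<dots>\<close> with
  rational coefficients. The outer exponent is that of \<open>t\<close>; negative ones are needed because a
  rooted hypertree without edges has weight \<open>1/t\<close>. The variable \<open>x\<close> of the generating series is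
  \<^const>\<open>fps_X\<close>.\<close>

type_synonym weight_ring = "int \<Rightarrow>\<^sub>0 ((nat \<Rightarrow>\<^sub>0 nat) \<Rightarrow>\<^sub>0 rat)"

definition const_w :: "rat \<Rightarrow> weight_ring" where
  "const_w c = Poly_Mapping.single 0 (Poly_Mapping.single 0 c)"

definition t_pow :: "int \<Rightarrow> weight_ring" where
  "t_pow k = Poly_Mapping.single k 1"

abbreviation t_var :: weight_ring where
  "t_var \<equiv> t_pow 1"

definition x_var :: "nat \<Rightarrow> weight_ring" where
  "x_var i = Poly_Mapping.single 0 (Poly_Mapping.single (Poly_Mapping.single i 1) 1)"

text \<open>The argument \<open>emb\<close> embeds the labels \<open>1, \<dots>, n\<close> into the vertices: the identity in the
  rooted case and \<open>Some\<close> in the hollow case. The petiole \<open>None\<close> of the edge containing the gap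
  thus contributes no variable.\<close>

definition weight :: "nat \<Rightarrow> (nat \<Rightarrow> 'a) \<Rightarrow> 'a set \<Rightarrow> 'a set set \<Rightarrow> 'a \<Rightarrow> weight_ring" where
  "weight n emb V E r =
     t_pow (int (card E) - 1) * (\<Prod>i=1..n. x_var i ^ card {e \<in> E. petiole V E r e = emb i})"

definition rooted_total_weight :: "nat \<Rightarrow> weight_ring" where
  "rooted_total_weight n =
     (\<Sum>(r, E, D) \<in> decorated_rooted_hypertrees {1..n}. weight n (\<lambda>i. i) {1..n} E r)"

definition hollow_total_weight :: "nat \<Rightarrow> weight_ring" where
  "hollow_total_weight n =
     (\<Sum>(E, D) \<in> decorated_hollow_hypertrees {1..n}.
        weight n Some (hollow_vertices {1..n}) E None)"

text \<open>The series with coefficients \<open>a\<^sub>n / n!\<close>, summed over \<open>n \<ge> m\<close>.\<close>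

definition exp_series_from :: "nat \<Rightarrow> (nat \<Rightarrow> weight_ring) \<Rightarrow> weight_ring fps" where
  "exp_series_from m a = Abs_fps (\<lambda>n. if n \<ge> m then a n * const_w (1 / fact n) else 0)"

definition S_rooted :: "weight_ring fps" where
  "S_rooted = exp_series_from 1 rooted_total_weight"

definition S_hollow :: "weight_ring fps" where
  "S_hollow = exp_series_from 1 hollow_total_weight"

end

theory Submission
  imports Defs
begin

text \<open>Attach the root of the rooted tree decorating an edge \<open>e\<close> to the petiole of \<open>e\<close>. The
  decorated hypertree becomes a rooted tree on the same vertices together with a set \<open>B\<close> of marked
  non-root vertices, namely the roots of the decorations, which contains all children of the root;
  the edges of the hypertree correspond to the marked vertices, and the petiole of an edge is the
  parent of the corresponding marked vertex. Summing over \<open>B\<close>, a child of \<open>i\<close> contributes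
  \<open>t x\<^sub>i + 1\<close>, or \<open>t x\<^sub>i\<close> if \<open>i\<close> is the root, so the weighted Cayley formula for forests evaluates
  the sum. A hollow hypertree corresponds to a tree in which the root has a single child.\<close>

section \<open>Trees as parent maps\<close>

text \<open>Trees are given by walks and missing cycles, and petioles by least distances, none of
  which can be summed over. Parent maps replace them: a tree with a chosen root amounts to a
  well-founded map to the parent, distance to the root becomes a number of iterations, and the same
  translation serves the incidence graph, the decorations and the final tree. Forests with arbitrary
  root sets are needed because the recursion for the Cayley formula makes the children of the roots
  into new roots.

  With weight \<open>t x\<^sub>i\<close> for every edge with petiole \<open>i\<close>, a structure
  has weight \<open>1/t\<close> times a product over its edges, and this \<open>1/t\<close> is
  absorbed by a factor that comes from the root: \<open>t x\<^sub>r\<close> becomes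
  \<open>x\<^sub>r\<close>, and \<open>t\<close> for the gap becomes 1. The summands
  \<open>n - 1\<close> and \<open>n\<close> in the bases of the powers count the vertices other than
  the root or the gap. The gap itself is absent from the base because it has a single child.\<close>

definition parent_map :: "'a set \<Rightarrow> 'a set \<Rightarrow> ('a \<Rightarrow> 'a) \<Rightarrow> bool" where
  "parent_map S A f \<longleftrightarrow> (\<forall>v\<in>S. f v \<in> S \<union> A) \<and> wf ((\<lambda>v. (f v, v)) ` S)"

text \<open>Relative to a set because it is measured to different targets: the root of a tree, the
  first level of a forest or the root of one decoration.\<close>

definition depth :: "'a set \<Rightarrow> ('a \<Rightarrow> 'a) \<Rightarrow> 'a \<Rightarrow> nat" where
  "depth S f v = (LEAST k. (f ^^ k) v \<notin> S)"

definition top_vertex :: "'a set \<Rightarrow> ('a \<Rightarrow> 'a) \<Rightarrow> 'a \<Rightarrow> 'a" where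
  "top_vertex S f v = (f ^^ depth S f v) v"

definition parent_edges :: "'a set \<Rightarrow> ('a \<Rightarrow> 'a) \<Rightarrow> 'a set set" where
  "parent_edges S f = (\<lambda>v. {v, f v}) ` S"

lemma parent_mapI:
  fixes h :: "'a \<Rightarrow> nat"
  assumes "\<And>v. v \<in> S \<Longrightarrow> f v \<in> S \<union> A" and "\<And>v. v \<in> S \<Longrightarrow> h (f v) < h v"
  shows "parent_map S A f"
  unfolding parent_map_def
proof
  have "(\<lambda>v. (f v, v)) ` S \<subseteq> measure h"
    using assms(2) by auto
  then show "wf ((\<lambda>v. (f v, v)) ` S)"
    by (rule wf_subset[OF wf_measure])
qed (use assms(1) in blast)

lemma parent_map_mem: "parent_map S A f \<Longrightarrow> v \<in> S \<Longrightarrow> f v \<in> S \<union> A"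
  by (auto simp: parent_map_def)

lemma parent_map_induct [consumes 1, case_names outside step]:
  assumes "wf ((\<lambda>v. (f v, v)) ` S)"
    and "\<And>v. v \<notin> S \<Longrightarrow> P v" and "\<And>v. v \<in> S \<Longrightarrow> P (f v) \<Longrightarrow> P v"
  shows "P v"
  using assms(1)
proof (induction v rule: wf_induct_rule)
  case (less v)
  then show ?case
    using assms(2,3) by blast
qed

lemma depth_outside: "v \<notin> S \<Longrightarrow> depth S f v = 0"
  by (simp add: depth_def)

lemma depth_step:
  assumes "wf ((\<lambda>v. (f v, v)) ` S)" and "v \<in> S"
  shows "depth S f v = Suc (depth S f (f v))"
proof -
  have "\<exists>k. (f ^^ k) v \<notin> S"
    using assms(1)
  proof (induction v rule: parent_map_induct)
    case (outside v)
    then show ?case by (intro exI[of _ 0]) simp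
  next
    case (step v)
    then obtain k where "(f ^^ k) (f v) \<notin> S" by blast
    then show ?case by (intro exI[of _ "Suc k"]) (simp add: funpow_swap1)
  qed
  then obtain k where "(f ^^ k) v \<notin> S" by blast
  then have "depth S f v = Suc (LEAST m. (f ^^ Suc m) v \<notin> S)"
    unfolding depth_def by (rule Least_Suc) (use assms(2) in simp)
  then show ?thesis
    by (simp add: depth_def funpow_swap1)
qed

lemma top_vertex_outside: "v \<notin> S \<Longrightarrow> top_vertex S f v = v"
  by (simp add: top_vertex_def depth_outside)

lemma top_vertex_step:
  "wf ((\<lambda>v. (f v, v)) ` S) \<Longrightarrow> v \<in> S \<Longrightarrow> top_vertex S f v = top_vertex S f (f v)"
  by (simp add: top_vertex_def depth_step funpow_swap1)

lemma parent_map_ne: "parent_map S A f \<Longrightarrow> v \<in> S \<Longrightarrow> f v \<noteq> v"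
  using depth_step[of f S v] by (auto simp: parent_map_def)

section \<open>Walks and cycles in graphs\<close>

lemma is_walk_snoc:
  "p \<noteq> [] \<Longrightarrow> is_walk V F (p @ [v]) \<longleftrightarrow> is_walk V F p \<and> v \<in> V \<and> {last p, v} \<in> F"
  by (auto simp: is_walk_def successively_append_iff)

lemma is_walk_rev: "is_walk V F p \<Longrightarrow> is_walk V F (rev p)"
  by (auto simp: is_walk_def insert_commute)

lemma is_walk_join:
  assumes "is_walk V F p" and "is_walk V F q" and "last p = hd q"
  shows "is_walk V F (p @ tl q) \<and> hd (p @ tl q) = hd p \<and> last (p @ tl q) = last q"
proof (cases q)
  case (Cons x xs)
  then show ?thesis
    using assms by (cases xs) (auto simp: is_walk_def successively_append_iff)
qed (use assms in \<open>simp add: is_walk_def\<close>)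

lemma graph_connectedI:
  assumes "r \<in> V" and "\<And>v. v \<in> V \<Longrightarrow> \<exists>p. is_walk V F p \<and> hd p = r \<and> last p = v"
  shows "graph_connected V F"
  unfolding graph_connected_def
proof (intro conjI ballI)
  fix u v assume "u \<in> V" "v \<in> V"
  then obtain p q where p: "is_walk V F p" "hd p = r" "last p = u"
    and q: "is_walk V F q" "hd q = r" "last q = v"
    using assms(2) by metis
  have "p \<noteq> []" using p(1) by (simp add: is_walk_def)
  then have "last (rev p) = hd q" "hd (rev p) = u"
    using p q by (simp_all add: last_rev hd_rev)
  then show "\<exists>p. is_walk V F p \<and> hd p = u \<and> last p = v"
    using is_walk_join[OF is_walk_rev[OF p(1)] q(1)] q(3) by metis
qed (use assms(1) in blast)

lemma distinct_walk:
  assumes "is_walk V F p"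
  shows "\<exists>q. is_walk V F q \<and> hd q = hd p \<and> last q = last p \<and> distinct q"
  using assms
proof (induction p rule: length_induct)
  case (1 p)
  show ?case
  proof (cases "distinct p")
    case False
    then obtain xs y ys zs where p: "p = xs @ [y] @ ys @ [y] @ zs"
      using not_distinct_decomp by blast
    \<comment> \<open>The loop from \<open>y\<close> back to \<open>y\<close> is cut out; one copy
      of \<open>y\<close> stays, so both ends survive even if \<open>xs\<close> or \<open>zs\<close>
      is empty.\<close>
    let ?q = "xs @ [y] @ zs"
    have "is_walk V F ?q"
      using "1.prems" unfolding p
      by (auto simp: is_walk_def successively_append_iff successively_Cons)
    moreover have "hd ?q = hd p" "last ?q = last p" "length ?q < length p"
      by (simp_all add: p hd_append)
    ultimately show ?thesis
      using "1.IH" by metis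
  qed (use "1.prems" in blast)
qed

lemma is_cycle_edge:
  assumes "is_cycle V F p" and "i < length p"
  shows "{p ! i, p ! (if Suc i = length p then 0 else Suc i)} \<in> F"
proof -
  have "p \<noteq> []" using assms by auto
  moreover have "length p - 1 = i" if "Suc i = length p"
    using that by simp
  ultimately show ?thesis
    using assms by (auto simp: is_cycle_def is_walk_def successively_conv_nth last_conv_nth hd_conv_nth)
qed

section \<open>Correspondence between trees with a chosen root and parent maps\<close>

context
  fixes V :: "'a set" and r :: 'a and f :: "'a \<Rightarrow> 'a"
  assumes root: "r \<in> V" and pm: "parent_map (V - {r}) {r} f"
begin

lemma depth_parent: "v \<in> V \<Longrightarrow> v \<noteq> r \<Longrightarrow> depth (V - {r}) f v = Suc (depth (V - {r}) f (f v))"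
  using pm by (auto simp: parent_map_def intro: depth_step)

lemma parent_edges_cases:
  assumes "{u, v} \<in> parent_edges (V - {r}) f"
  obtains "u \<in> V" "u \<noteq> r" "v = f u" | "v \<in> V" "v \<noteq> r" "u = f v"
proof -
  obtain w where "w \<in> V" "w \<noteq> r" "{u, v} = {w, f w}"
    using assms by (auto simp: parent_edges_def)
  then show thesis
    using that by (auto simp: doubleton_eq_iff)
qed

lemma walk_from_root:
  assumes "v \<in> V"
  shows "\<exists>p. is_walk V (parent_edges (V - {r}) f) p \<and> hd p = r \<and> last p = v \<and>
           length p = Suc (depth (V - {r}) f v)"
proof -
  have "wf ((\<lambda>v. (f v, v)) ` (V - {r}))"
    using pm by (simp add: parent_map_def)
  then have "v \<in> V \<longrightarrow> ?thesis"
  proof (induction v rule: parent_map_induct)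
    case (outside v)
    then show ?case
      using root by (auto simp: is_walk_def depth_outside intro!: exI[of _ "[r]"])
  next
    case (step v)
    have "f v \<in> V" using parent_map_mem[OF pm step(1)] root by auto
    with step.IH obtain p where "is_walk V (parent_edges (V - {r}) f) p" "hd p = r" "last p = f v"
      "length p = Suc (depth (V - {r}) f (f v))" by blast
    moreover from this have "p \<noteq> []" by auto
    moreover have "{f v, v} \<in> parent_edges (V - {r}) f"
      using step(1) by (auto simp: parent_edges_def insert_commute)
    ultimately show ?case
      using step(1) by (intro impI exI[of _ "p @ [v]"]) (simp add: is_walk_snoc depth_parent)
  qed
  with assms show ?thesis by blast
qed

text \<open>An edge changes the depth by exactly one, so a walk cannot raise it by more than its
  number of edges. This is the lower bound for the distance from \<open>r\<close>.\<close>

lemma depth_walk: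
  assumes "is_walk V (parent_edges (V - {r}) f) p"
  shows "depth (V - {r}) f (last p) < depth (V - {r}) f (hd p) + length p"
  using assms
proof (induction p rule: rev_induct)
  case (snoc v p)
  show ?case
  proof (cases "p = []")
    case False
    then have "depth (V - {r}) f v \<le> Suc (depth (V - {r}) f (last p))"
      using snoc.prems by (auto simp: is_walk_snoc depth_parent elim!: parent_edges_cases)
    then show ?thesis
      using snoc False by (auto simp: is_walk_snoc)
  qed simp
qed (simp add: is_walk_def)

lemma graph_dist_parent_edges:
  assumes "v \<in> V"
  shows "graph_dist V (parent_edges (V - {r}) f) r v = depth (V - {r}) f v"
  unfolding graph_dist_def
proof (rule Least_equality)
  fix k
  assume "\<exists>p. is_walk V (parent_edges (V - {r}) f) p \<and> hd p = r \<and> last p = v \<and> length p = Suc k"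
  then show "depth (V - {r}) f v \<le> k"
    using depth_walk by (fastforce simp: depth_outside)
qed (rule walk_from_root[OF assms])

lemma is_tree_parent_edges:
  assumes "finite V"
  shows "is_tree V (parent_edges (V - {r}) f)"
  unfolding is_tree_def
proof (intro conjI)
  show "simple_graph V (parent_edges (V - {r}) f)"
    using assms parent_map_mem[OF pm] parent_map_ne[OF pm] root
    by (auto simp: simple_graph_def parent_edges_def card_2_iff)
  show "graph_connected V (parent_edges (V - {r}) f)"
    using root by (rule graph_connectedI) (use walk_from_root in blast)
  show "\<nexists>p. is_cycle V (parent_edges (V - {r}) f) p"
  proof
    assume "\<exists>p. is_cycle V (parent_edges (V - {r}) f) p"
    then obtain p where cyc: "is_cycle V (parent_edges (V - {r}) f) p" by blast
    let ?d = "\<lambda>i. depth (V - {r}) f (p ! i)"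
    have len: "length p \<ge> 3" and dist: "distinct p"
      using cyc by (auto simp: is_cycle_def)
    obtain i where i: "i < length p" and max: "\<And>j. j < length p \<Longrightarrow> ?d j \<le> ?d i"
      using len Max_in[of "?d ` {..<length p}"] Max_ge[of "?d ` {..<length p}"]
      by (fastforce simp: lessThan_empty_iff)
    \<comment> \<open>\<open>j\<close> and \<open>k\<close> are the cyclic successor and predecessor
      of position \<open>i\<close>; they differ because a cycle has at least three vertices.\<close>
    define j where "j = (if Suc i = length p then 0 else Suc i)"
    define k where "k = (if i = 0 then length p - 1 else i - 1)"
    have jk: "j < length p" "k < length p" "j \<noteq> k" and ki: "(if Suc k = length p then 0 else Suc k) = i"
      using i len by (auto simp: j_def k_def)
    \<comment> \<open>Both neighbours on the cycle of a vertex of maximal depth are its parent.\<close>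
    have "{p ! i, p ! j} \<in> parent_edges (V - {r}) f"
      using is_cycle_edge[OF cyc i] by (simp add: j_def)
    then have "p ! j = f (p ! i)"
      using max[OF jk(1)] by (auto simp: depth_parent elim!: parent_edges_cases)
    moreover have "{p ! k, p ! i} \<in> parent_edges (V - {r}) f"
      using is_cycle_edge[OF cyc jk(2)] unfolding ki .
    then have "p ! k = f (p ! i)"
      using max[OF jk(2)] by (auto simp: depth_parent elim!: parent_edges_cases)
    ultimately show False
      using jk dist by (metis nth_eq_iff_index_eq)
  qed
qed

end

text \<open>The edge set determines the distances to \<open>r\<close>, hence the depths for both
  maps. If \<open>{v, f v}\<close> were not the parent edge of \<open>v\<close> under
  \<open>g\<close>, it would be that of \<open>f v\<close>, and the two maps would disagree on which
  end is deeper.\<close>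

lemma parent_edges_inj:
  assumes "r \<in> V" and f: "parent_map (V - {r}) {r} f" and g: "parent_map (V - {r}) {r} g"
    and eq: "parent_edges (V - {r}) f = parent_edges (V - {r}) g" and "v \<in> V - {r}"
  shows "f v = g v"
proof -
  have depth_eq: "depth (V - {r}) f u = depth (V - {r}) g u" if "u \<in> V" for u
    using graph_dist_parent_edges[OF \<open>r \<in> V\<close> f that] graph_dist_parent_edges[OF \<open>r \<in> V\<close> g that] eq
    by simp
  have "{v, f v} \<in> parent_edges (V - {r}) g"
    using assms(5) eq by (auto simp: parent_edges_def)
  then consider "f v = g v" | "f v \<in> V" "f v \<noteq> r" "v = g (f v)"
    by (rule parent_edges_cases[OF \<open>r \<in> V\<close> g])
  then show ?thesis
  proof cases
    case 2
    then have "depth (V - {r}) g (f v) = Suc (depth (V - {r}) g v)"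
      using depth_parent[OF \<open>r \<in> V\<close> g] by metis
    moreover have "depth (V - {r}) f v = Suc (depth (V - {r}) f (f v))"
      using depth_parent[OF \<open>r \<in> V\<close> f] assms(5) by auto
    ultimately show ?thesis
      using depth_eq 2 assms(5) by auto
  qed auto
qed

text \<open>The parent of \<open>v\<close> is the last but one vertex on a shortest walk from
  \<open>r\<close>. The parent edges then already connect all vertices, so any further edge of
  \<open>F\<close> would close a cycle.\<close>

lemma is_tree_parent_map:
  assumes tree: "is_tree V F" and "r \<in> V"
  shows "\<exists>f. parent_map (V - {r}) {r} f \<and> F = parent_edges (V - {r}) f"
proof -
  let ?d = "graph_dist V F r"
  let ?W = "\<lambda>v k p. is_walk V F p \<and> hd p = r \<and> last p = v \<and> length p = Suc k"
  have sg: "simple_graph V F" and conn: "graph_connected V F" and nocyc: "\<nexists>p. is_cycle V F p"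
    using tree by (auto simp: is_tree_def)
  have "\<exists>u. u \<in> V \<and> {u, v} \<in> F \<and> ?d u < ?d v" if v: "v \<in> V - {r}" for v
  proof -
    obtain p where "is_walk V F p" "hd p = r" "last p = v"
      using conn \<open>r \<in> V\<close> v by (auto simp: graph_connected_def)
    then have "?W v (length p - 1) p" by (cases p) (auto simp: is_walk_def)
    then have "\<exists>p. ?W v (?d v) p"
      unfolding graph_dist_def by (intro LeastI) blast
    then obtain p where p: "?W v (?d v) p" by blast
    then obtain q x where "p = q @ [x]" by (cases p rule: rev_cases) auto
    with p v have q: "p = q @ [v]" "q \<noteq> []" by auto
    with p have walk: "is_walk V F q" and edge: "{last q, v} \<in> F" by (auto simp: is_walk_snoc)
    have "?W (last q) (length q - 1) q"
      using walk p q by (cases q) auto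
    then have "?d (last q) \<le> length q - 1"
      unfolding graph_dist_def by (intro Least_le) blast
    moreover have "length q = ?d v" using p q by simp
    moreover have "last q \<in> V" using walk q(2) by (auto simp: is_walk_def)
    moreover have "length q > 0" using q by simp
    ultimately show ?thesis using edge by (intro exI[of _ "last q"]) linarith+
  qed
  then obtain f where f: "\<And>v. v \<in> V - {r} \<Longrightarrow> f v \<in> V \<and> {f v, v} \<in> F \<and> ?d (f v) < ?d v"
    by metis
  have pm: "parent_map (V - {r}) {r} f"
    by (rule parent_mapI[where h = ?d]) (use f in auto)
  have sub: "parent_edges (V - {r}) f \<subseteq> F"
    using f by (auto simp: parent_edges_def insert_commute)
  have "F \<subseteq> parent_edges (V - {r}) f"
  proof (rule ccontr)
    assume "\<not> ?thesis"
    then obtain e where e: "e \<in> F" "e \<notin> parent_edges (V - {r}) f" by blast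
    then obtain u v where uv: "e = {u, v}" "u \<noteq> v" "u \<in> V" "v \<in> V"
      using sg by (auto simp: simple_graph_def card_2_iff)
    have "graph_connected V (parent_edges (V - {r}) f)"
      using is_tree_parent_edges[OF \<open>r \<in> V\<close> pm] sg by (auto simp: is_tree_def simple_graph_def)
    then obtain p where "is_walk V (parent_edges (V - {r}) f) p" "hd p = u" "last p = v"
      using uv by (auto simp: graph_connected_def)
    then obtain q where q: "is_walk V (parent_edges (V - {r}) f) q" "hd q = u" "last q = v" "distinct q"
      using distinct_walk by metis
    \<comment> \<open>One vertex would mean \<open>u = v\<close>, and two would make
      \<open>e\<close> a parent edge.\<close>
    have "length q \<ge> 3"
    proof (rule ccontr)
      assume "\<not> ?thesis"
      then consider "q = []" | x where "q = [x]" | x y where "q = [x, y]"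
        by (cases q; cases "tl q"; cases "tl (tl q)") auto
      then show False
        by cases (use q uv e in \<open>auto simp: is_walk_def\<close>)
    qed
    moreover have "is_walk V F q"
      using q(1) sub by (auto simp: is_walk_def elim: successively_mono)
    ultimately have "is_cycle V F q"
      using q e uv by (simp add: is_cycle_def insert_commute)
    with nocyc show False by blast
  qed
  with sub pm show ?thesis by blast
qed

section \<open>The weighted Cayley formula\<close>

text \<open>Values outside \<open>S\<close> are fixed, so that a sum over this set counts every
  forest once.\<close>

definition parent_maps :: "'a set \<Rightarrow> 'a set \<Rightarrow> ('a \<Rightarrow> 'a) set" where
  "parent_maps S A = {f \<in> S \<rightarrow>\<^sub>E S \<union> A. parent_map S A f}"

lemma finite_parent_maps: "finite S \<Longrightarrow> finite A \<Longrightarrow> finite (parent_maps S A)"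
  unfolding parent_maps_def by (rule finite_subset[OF _ finite_PiE[of S "\<lambda>_. S \<union> A"]]) auto

lemma parent_map_cong: "(\<And>v. v \<in> S \<Longrightarrow> f v = g v) \<Longrightarrow> parent_map S A f = parent_map S A g"
  by (simp add: parent_map_def cong: image_cong)

lemma parent_maps_empty [simp]: "parent_maps {} A = {\<lambda>_. undefined}"
  by (auto simp: parent_maps_def parent_map_def)

text \<open>A well-founded climb has to leave \<open>S\<close>, and without roots there is nowhere
  to go. This disposes of the empty first level in the recursion.\<close>

lemma parent_map_no_roots:
  assumes "parent_map S {} f"
  shows "S = {}"
proof -
  have "wf ((\<lambda>v. (f v, v)) ` S)" using assms by (simp add: parent_map_def)
  then have "v \<notin> S" for v
  proof (induction v rule: parent_map_induct)
    case (step v)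
    then show ?case using parent_map_mem[OF assms, of v] by blast
  qed
  then show ?thesis by blast
qed

lemma parent_map_level:
  assumes "parent_map S A f"
  shows "parent_map (S - {v \<in> S. f v \<in> A}) {v \<in> S. f v \<in> A} f"
  using assms unfolding parent_map_def by (auto elim!: wf_subset)

lemma parent_map_add_level:
  assumes "L \<subseteq> S" and "S \<inter> A = {}" and "parent_map (S - L) L f" and "f ` L \<subseteq> A"
  shows "parent_map S A f"
\<comment> \<open>A height function with \<open>A\<close> at 0, \<open>L\<close> at 1 and the rest
  of \<open>S\<close> above its parents.\<close>
proof (rule parent_mapI[where h = "\<lambda>v. if v \<in> S then Suc (depth (S - L) f v) else 0"])
  fix v assume v: "v \<in> S"
  show "f v \<in> S \<union> A"
    using v assms(1,4) parent_map_mem[OF assms(3), of v] by blast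
  show "(if f v \<in> S then Suc (depth (S - L) f (f v)) else 0) < (if v \<in> S then Suc (depth (S - L) f v) else 0)"
  proof (cases "v \<in> L")
    case True
    then have "f v \<notin> S" using assms(2,4) by blast
    then show ?thesis using v by simp
  next
    case False
    then show ?thesis
      using v depth_step[of f "S - L" v] assms(3) by (simp add: parent_map_def)
  qed
qed

text \<open>A forest in which \<open>L\<close> is the set of children of the roots is an arbitrary
  map from \<open>L\<close> to \<open>A\<close> together with a forest on \<open>S - L\<close>
  rooted at \<open>L\<close>. The free map contributes the power of \<open>sum y A\<close>.\<close>

lemma sum_parent_maps_level:
  fixes y :: "'a \<Rightarrow> 'b::comm_semiring_1"
  assumes "finite S" "finite A" "S \<inter> A = {}" "L \<subseteq> S"
  shows "(\<Sum>f | f \<in> parent_maps S A \<and> {v \<in> S. f v \<in> A} = L. \<Prod>v\<in>S. y (f v)) =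
           sum y A ^ card L * (\<Sum>f\<in>parent_maps (S - L) L. \<Prod>v\<in>S - L. y (f v))"
proof -
  have fin: "finite L" using assms finite_subset by blast
  have "sum y A ^ card L * (\<Sum>f\<in>parent_maps (S - L) L. \<Prod>v\<in>S - L. y (f v)) =
      (\<Sum>g\<in>L \<rightarrow>\<^sub>E A. \<Prod>v\<in>L. y (g v)) * (\<Sum>f\<in>parent_maps (S - L) L. \<Prod>v\<in>S - L. y (f v))"
    using prod_sum_PiE[OF fin, of "\<lambda>_. A" "\<lambda>_. y"] assms(2) by simp
  also have "\<dots> = (\<Sum>(g, f)\<in>(L \<rightarrow>\<^sub>E A) \<times> parent_maps (S - L) L. (\<Prod>v\<in>L. y (g v)) * (\<Prod>v\<in>S - L. y (f v)))"
    by (simp add: sum_product sum.cartesian_product)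
  also have "\<dots> = (\<Sum>f | f \<in> parent_maps S A \<and> {v \<in> S. f v \<in> A} = L. \<Prod>v\<in>S. y (f v))"
  proof (rule sum.reindex_bij_witness[where j = "\<lambda>(g, f) v. if v \<in> L then g v else f v"
        and i = "\<lambda>f. (restrict f L, restrict f (S - L))"], goal_cases)
    case (1 p)
    then show ?case
      by (auto simp: parent_maps_def PiE_def extensional_def fun_eq_iff restrict_def)
  next
    case (2 p)
    obtain g f where p: "p = (g, f)" "g \<in> L \<rightarrow>\<^sub>E A" "f \<in> parent_maps (S - L) L"
      using 2 by auto
    let ?h = "\<lambda>v. if v \<in> L then g v else f v"
    have "parent_map (S - L) L f" using p by (simp add: parent_maps_def)
    then have pm: "parent_map (S - L) L ?h"
      by (subst parent_map_cong[of _ _ f]) auto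
    have gA: "?h ` L \<subseteq> A" using p by auto
    have "parent_map S A ?h"
      using parent_map_add_level[OF assms(4,3) pm gA] .
    moreover have "?h \<in> S \<rightarrow>\<^sub>E S \<union> A"
      using parent_map_mem[OF calculation] p assms(4)
      by (auto simp: parent_maps_def PiE_def extensional_def)
    moreover have "?h v \<notin> A" if "v \<in> S - L" for v
      using parent_map_mem[OF pm that] assms(3,4) by blast
    then have "{v \<in> S. ?h v \<in> A} = L"
      using assms(4) gA by blast
    ultimately show ?case by (simp add: p parent_maps_def)
  next
    case (3 f)
    then show ?case
      using assms(4) by (auto simp: parent_maps_def PiE_def extensional_def fun_eq_iff restrict_def)
  next
    case (4 f)
    then have f: "f \<in> S \<rightarrow>\<^sub>E S \<union> A" "parent_map S A f" and L: "{v \<in> S. f v \<in> A} = L"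
      by (auto simp: parent_maps_def)
    have pm: "parent_map (S - L) L f"
      using parent_map_level[OF f(2)] unfolding L .
    then have "parent_map (S - L) L (restrict f (S - L))"
      by (subst parent_map_cong[of _ _ f]) auto
    then show ?case
      using parent_map_mem[OF pm] L by (auto simp: parent_maps_def)
  next
    case (5 p)
    obtain g f where p: "p = (g, f)" by (cases p)
    have "(\<Prod>v\<in>S. y (if v \<in> L then g v else f v)) =
        (\<Prod>v\<in>S - L. y (if v \<in> L then g v else f v)) * (\<Prod>v\<in>L. y (if v \<in> L then g v else f v))"
      by (rule prod.subset_diff[OF assms(4,1)])
    also have "\<dots> = (\<Prod>v\<in>L. y (g v)) * (\<Prod>v\<in>S - L. y (f v))"
      by (subst mult.commute) (intro arg_cong2[of _ _ _ _ "(*)"] prod.cong, auto)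
    finally show ?case using p by simp
  qed
  finally show ?thesis ..
qed

lemma sum_Pow_card:
  fixes g :: "nat \<Rightarrow> 'b::comm_semiring_1"
  assumes "finite U"
  shows "(\<Sum>M\<in>Pow U. g (card M)) = (\<Sum>j\<le>card U. of_nat (card U choose j) * g j)"
proof -
  have "(\<Sum>M\<in>Pow U. g (card M)) = (\<Sum>j\<le>card U. \<Sum>M | M \<in> Pow U \<and> card M = j. g (card M))"
    using assms by (intro sum.group[symmetric]) (auto intro: card_mono)
  also have "\<dots> = (\<Sum>j\<le>card U. of_nat (card U choose j) * g j)"
    using n_subsets[OF assms] by (intro sum.cong) simp_all
  finally show ?thesis .
qed

text \<open>Grouping the forests by the set \<open>L\<close> of children of the roots \<open>A\<close> reduces a forest on
  \<open>S\<close> to one on \<open>S - L\<close> with roots \<open>L\<close>.\<close>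

theorem sum_parent_maps:
  fixes y :: "'a \<Rightarrow> 'b::comm_semiring_1"
  assumes "finite S" "finite A" "S \<inter> A = {}"
  shows "(\<Sum>f\<in>parent_maps S A. \<Prod>v\<in>S. y (f v)) =
           (if S = {} then 1 else sum y A * (sum y A + sum y S) ^ (card S - 1))"
  using assms
proof (induction "card S" arbitrary: S A rule: less_induct)
  case less
  show ?case
  proof (cases "S = {}")
    case False
    define m where "m = card S"
    define k where "k = m - 1"
    define a b where "a = sum y A" and "b = sum y S"
    \<comment> \<open>By the induction hypothesis, the forests whose first level is a nonempty
      proper subset \<open>L\<close> have total weight \<open>sum y L * q (card L)\<close>. For
      \<open>L = S\<close> nothing remains above the first level and the total is
      \<open>a ^ m\<close>, which is kept as a separate term.\<close>
    define q where "q l = (if l = m then 0 else a ^ l * b ^ (m - 1 - l))" for l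
    \<comment> \<open>\<open>T\<close> plays the role of \<open>((a + b) ^ k - a ^ k) / b\<close>,
      written out because a semiring has neither subtraction nor division.\<close>
    define T where "T = (\<Sum>j\<le>k. of_nat (k choose j) * (if j = k then 0 else a ^ j * b ^ (k - 1 - j)))"
    have m: "m = Suc k"
      using False less.prems by (simp add: m_def k_def card_gt_0_iff)
    have level: "(\<Sum>f | f \<in> parent_maps S A \<and> {v \<in> S. f v \<in> A} = L. \<Prod>v\<in>S. y (f v)) =
        (if L = S then a ^ m else 0) + sum y L * q (card L)" if L: "L \<subseteq> S" for L
    proof -
      have fin: "finite L" using L less.prems finite_subset by blast
      consider "L = {}" | "L = S" | "L \<noteq> {}" "L \<subset> S" using L by blast
      then have "a ^ card L * (\<Sum>f\<in>parent_maps (S - L) L. \<Prod>v\<in>S - L. y (f v)) =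
        (if L = S then a ^ m else 0) + sum y L * q (card L)"
      proof cases
        case 1
        then have "parent_maps (S - L) L = {}"
          using False parent_map_no_roots by (auto simp: parent_maps_def)
        then show ?thesis using 1 False by simp
      next
        case 2
        then show ?thesis by (simp add: m_def q_def)
      next
        case 3
        have c: "card L < m"
          using 3 less.prems by (simp add: m_def psubset_card_mono)
        have c': "card (S - L) = m - card L"
          using L fin by (simp add: m_def card_Diff_subset)
        have "sum y L + sum y (S - L) = b"
          using sum.subset_diff[OF L less.prems(1), of y] by (simp add: b_def add.commute)
        moreover have "card (S - L) < card S"
          using c c' 3 fin card_gt_0_iff[of L] by (simp add: m_def)
        ultimately show ?thesis
          using less.hyps[of "S - L" L] less.prems fin 3 c c' by (auto simp: q_def ac_simps)
      qed
      then show ?thesis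
        using sum_parent_maps_level[OF less.prems L, of y] by (simp add: a_def)
    qed
    \<comment> \<open>\<open>sum y L\<close> will be expanded over \<open>s\<close> and the two sums
      exchanged. The sum over all \<open>L\<close> containing \<open>s\<close> is the same for every
      \<open>s\<close>, since only the size of \<open>L - {s}\<close> enters.\<close>
    have containing: "(\<Sum>L | L \<in> Pow S \<and> s \<in> L. q (card L)) = a * T" if s: "s \<in> S" for s
    proof -
      have "(\<Sum>L | L \<in> Pow S \<and> s \<in> L. q (card L)) = (\<Sum>M\<in>Pow (S - {s}). q (Suc (card M)))"
        by (rule sum.reindex_bij_witness[where i = "insert s" and j = "\<lambda>L. L - {s}"])
          (use s less.prems(1) in \<open>auto simp: insert_absorb card_Suc_Diff1 simp del: card_Diff_insert dest: finite_subset\<close>)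
      also have "\<dots> = (\<Sum>j\<le>k. of_nat (k choose j) * q (Suc j))"
        using sum_Pow_card[of "S - {s}" "\<lambda>j. q (Suc j)"] s less.prems(1)
        by (simp add: k_def m_def)
      also have "\<dots> = a * T"
        unfolding T_def sum_distrib_left by (rule sum.cong) (auto simp: q_def m ac_simps)
      finally show ?thesis .
    qed
    have "(a + b) ^ k = (\<Sum>j\<le>k. of_nat (k choose j) * a ^ j * b ^ (k - j))"
      by (rule binomial_ring)
    also have "\<dots> = (\<Sum>j\<le>k. (if j = k then a ^ k else 0) +
        b * (of_nat (k choose j) * (if j = k then 0 else a ^ j * b ^ (k - 1 - j))))"
    proof (rule sum.cong)
      fix j assume "j \<in> {..k}"
      then have "k - j = Suc (k - 1 - j)" if "j \<noteq> k" using that by auto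
      then show "of_nat (k choose j) * a ^ j * b ^ (k - j) = (if j = k then a ^ k else 0) +
        b * (of_nat (k choose j) * (if j = k then 0 else a ^ j * b ^ (k - 1 - j)))"
        by (auto simp: ac_simps)
    qed simp
    also have "\<dots> = a ^ k + b * T"
      by (simp add: sum.distrib T_def sum_distrib_left)
    finally have binom: "(a + b) ^ k = a ^ k + b * T" .
    have "(\<Sum>f\<in>parent_maps S A. \<Prod>v\<in>S. y (f v)) =
        (\<Sum>L\<in>Pow S. \<Sum>f | f \<in> parent_maps S A \<and> {v \<in> S. f v \<in> A} = L. \<Prod>v\<in>S. y (f v))"
      using less.prems by (intro sum.group[symmetric]) (auto simp: finite_parent_maps)
    also have "\<dots> = (\<Sum>L\<in>Pow S. (if L = S then a ^ m else 0) + sum y L * q (card L))"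
      using level by (intro sum.cong) auto
    also have "\<dots> = a ^ m + (\<Sum>L\<in>Pow S. \<Sum>s | s \<in> S \<and> s \<in> L. y s * q (card L))"
    proof -
      have "sum y L * q (card L) = (\<Sum>s | s \<in> S \<and> s \<in> L. y s * q (card L))" if "L \<in> Pow S" for L
      proof -
        have "{s. s \<in> S \<and> s \<in> L} = L" using that by auto
        then show ?thesis by (simp add: sum_distrib_right)
      qed
      then show ?thesis
        using less.prems(1) by (simp add: sum.distrib)
    qed
    also have "\<dots> = a ^ m + (\<Sum>s\<in>S. \<Sum>L | L \<in> Pow S \<and> s \<in> L. y s * q (card L))"
      using less.prems(1) by (subst sum.swap_restrict) auto
    also have "\<dots> = a ^ m + (\<Sum>s\<in>S. y s * (a * T))"
      using containing by (simp flip: sum_distrib_left cong: sum.cong)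
    also have "(\<Sum>s\<in>S. y s * (a * T)) = b * (a * T)"
      by (simp add: b_def sum_distrib_right)
    also have "a ^ m + b * (a * T) = a * (a + b) ^ k"
      by (simp add: binom m algebra_simps)
    finally show ?thesis
      using False by (simp add: a_def b_def k_def m_def)
  qed simp
qed

section \<open>Hypertrees and their petioles\<close>

text \<open>An intrinsic description of a hypertree rooted at \<open>r\<close> through the parent of each vertex in the
  incidence tree; \<open>p\<close> is then forced to be the petiole.\<close>

definition petiole_system :: "'a set \<Rightarrow> 'a \<Rightarrow> 'a set set \<Rightarrow> ('a set \<Rightarrow> 'a) \<Rightarrow> bool" where
  "petiole_system V r E p \<longleftrightarrow>
     finite V \<and> r \<in> V \<and>
     (\<forall>e\<in>E. e \<subseteq> V \<and> p e \<in> e \<and> e - {p e} \<noteq> {} \<and> r \<notin> e - {p e}) \<and>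
     (\<forall>v\<in>V - {r}. \<exists>!e. e \<in> E \<and> v \<in> e - {p e}) \<and>
     wf {(p e, v) |e v. e \<in> E \<and> v \<in> e - {p e}}"

text \<open>Every incidence joins a child to its parent. As \<open>u\<close> is already the parent
  of \<open>e\<close>, any other vertex of \<open>e\<close> must be a child of
  \<open>e\<close>.\<close>

lemma incidence_parent:
  assumes "r \<in> V" and pm: "parent_map (incidence_vertices V E - {Inl r}) {Inl r} \<phi>"
    and inc: "incidence_edges E = parent_edges (incidence_vertices V E - {Inl r}) \<phi>"
    and "e \<in> E" and "\<phi> (Inr e) = Inl u" and "v \<in> e" and "v \<noteq> u"
  shows "v \<in> V" and "v \<noteq> r" and "\<phi> (Inl v) = Inr e"
proof -
  have root: "Inl r \<in> incidence_vertices V E"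
    using \<open>r \<in> V\<close> by (auto simp: incidence_vertices_def)
  have "{Inl v, Inr e} \<in> parent_edges (incidence_vertices V E - {Inl r}) \<phi>"
    unfolding inc[symmetric] using assms by (auto simp: incidence_edges_def)
  then have "v \<in> V \<and> v \<noteq> r \<and> \<phi> (Inl v) = Inr e"
    by (rule parent_edges_cases[OF root pm])
      (use assms in \<open>auto simp: incidence_vertices_def\<close>)
  then show "v \<in> V" "v \<noteq> r" "\<phi> (Inl v) = Inr e" by auto
qed

text \<open>In the rooted incidence tree the other vertices of \<open>e\<close> are grandchildren of
  \<open>u\<close>, so the least distance is attained at \<open>u\<close> alone.\<close>

lemma petiole_eq:
  assumes "r \<in> V" and pm: "parent_map (incidence_vertices V E - {Inl r}) {Inl r} \<phi>"
    and inc: "incidence_edges E = parent_edges (incidence_vertices V E - {Inl r}) \<phi>"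
    and "e \<in> E" and "e \<subseteq> V" and "\<phi> (Inr e) = Inl u" and "u \<in> e"
  shows "petiole V E r e = u"
proof -
  define N where "N = incidence_vertices V E"
  define d where "d = (\<lambda>v. graph_dist (incidence_vertices V E) (incidence_edges E) (Inl r) (Inl v))"
  have root: "Inl r \<in> N"
    using \<open>r \<in> V\<close> by (auto simp: N_def incidence_vertices_def)
  have pm': "parent_map (N - {Inl r}) {Inl r} \<phi>" using pm by (simp add: N_def)
  have d: "d v = depth (N - {Inl r}) \<phi> (Inl v)" if "v \<in> V" for v
    unfolding d_def inc N_def[symmetric]
    by (rule graph_dist_parent_edges[OF root pm']) (use that in \<open>auto simp: N_def incidence_vertices_def\<close>)
  have lt: "d u < d v" if v: "v \<in> e" "v \<noteq> u" for v
  proof -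
    note * = incidence_parent[OF assms(1-4,6) v]
    have "Inl v \<in> N" "Inr e \<in> N"
      using * \<open>e \<in> E\<close> by (auto simp: N_def incidence_vertices_def)
    then show ?thesis
      using * d[of u] d[of v] depth_parent[OF root pm', of "Inl v"] depth_parent[OF root pm', of "Inr e"] assms
      by auto
  qed
  have "arg_min d (\<lambda>v. v \<in> e) \<in> e \<and> d (arg_min d (\<lambda>v. v \<in> e)) \<le> d u"
    using arg_min_nat_lemma[of "\<lambda>v. v \<in> e" u d] \<open>u \<in> e\<close> by blast
  then have "arg_min d (\<lambda>v. v \<in> e) = u"
    using lt by (meson not_le)
  then show ?thesis
    unfolding petiole_def arg_min_on_def d_def .
qed

text \<open>Root the incidence tree at \<open>Inl r\<close>: the parent of an edge is its petiole,
  and the parent of a vertex other than \<open>r\<close> is the only edge that contains it as a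
  non-petiole. Depth in this tree gives well-foundedness.\<close>

lemma hypertree_petiole_system:
  assumes hyp: "hypertree V E" and "r \<in> V"
  shows "petiole_system V r E (petiole V E r)"
proof -
  define N where "N = incidence_vertices V E"
  have root: "Inl r \<in> N"
    using \<open>r \<in> V\<close> by (auto simp: N_def incidence_vertices_def)
  have fin: "finite V" and edge: "\<And>e. e \<in> E \<Longrightarrow> e \<subseteq> V \<and> card e \<ge> 2"
    and tree: "is_tree N (incidence_edges E)"
    using hyp by (auto simp: hypertree_def N_def)
  obtain \<phi> where pm: "parent_map (N - {Inl r}) {Inl r} \<phi>"
    and inc: "incidence_edges E = parent_edges (N - {Inl r}) \<phi>"
    using is_tree_parent_map[OF tree root] by blast
  note pm' = pm[unfolded N_def] and inc' = inc[unfolded N_def]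
  have par: "{x, \<phi> x} \<in> incidence_edges E" if "x \<in> N" "x \<noteq> Inl r" for x
    unfolding inc using that by (auto simp: parent_edges_def)
  have pet: "\<phi> (Inr e) = Inl (petiole V E r e) \<and> petiole V E r e \<in> e" if e: "e \<in> E" for e
  proof -
    have "{Inr e, \<phi> (Inr e)} \<in> incidence_edges E"
      by (rule par) (use e in \<open>auto simp: N_def incidence_vertices_def\<close>)
    then obtain u where "\<phi> (Inr e) = Inl u" "u \<in> e"
      by (auto simp: incidence_edges_def doubleton_eq_iff)
    moreover from this have "petiole V E r e = u"
      using petiole_eq[OF \<open>r \<in> V\<close> pm' inc' e] edge[OF e] by blast
    ultimately show ?thesis by simp
  qed
  note up = incidence_parent[OF \<open>r \<in> V\<close> pm' inc' _ conjunct1[OF pet]]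
  have lower: "depth (N - {Inl r}) \<phi> (Inl (petiole V E r e)) < depth (N - {Inl r}) \<phi> (Inl v)"
    if e: "e \<in> E" and v: "v \<in> e - {petiole V E r e}" for e v
  proof -
    have "Inl v \<in> N" "Inr e \<in> N" "v \<noteq> r" "\<phi> (Inl v) = Inr e"
      using up[of e v] e v by (auto simp: N_def incidence_vertices_def)
    then show ?thesis
      using depth_parent[OF root pm, of "Inl v"] depth_parent[OF root pm, of "Inr e"] pet[OF e]
      by auto
  qed
  show ?thesis
    unfolding petiole_system_def
  proof (intro conjI ballI)
    fix e assume e: "e \<in> E"
    show "e - {petiole V E r e} \<noteq> {}"
    proof
      assume "e - {petiole V E r e} = {}"
      then have "card e \<le> card {petiole V E r e}" by (intro card_mono) auto
      then show False using edge[OF e] by simp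
    qed
    show "r \<notin> e - {petiole V E r e}"
      using up(2)[OF e e] by blast
  next
    fix v assume v: "v \<in> V - {r}"
    have "{Inl v, \<phi> (Inl v)} \<in> incidence_edges E"
      by (rule par) (use v in \<open>auto simp: N_def incidence_vertices_def\<close>)
    then obtain e where e: "\<phi> (Inl v) = Inr e" "v \<in> e" "e \<in> E"
      by (auto simp: incidence_edges_def doubleton_eq_iff)
    \<comment> \<open>Otherwise \<open>v\<close> and \<open>e\<close> would be parents of each
      other.\<close>
    have "v \<noteq> petiole V E r e"
    proof
      assume "v = petiole V E r e"
      then have "\<phi> (Inr e) = Inl v" using pet[OF e(3)] by simp
      moreover have "Inl v \<in> N" and "Inr e \<in> N"
        using e v by (auto simp: N_def incidence_vertices_def)
      ultimately have "depth (N - {Inl r}) \<phi> (Inr e) = Suc (depth (N - {Inl r}) \<phi> (Inl v))"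
        using depth_parent[OF root pm, of "Inr e"] by simp
      moreover have "depth (N - {Inl r}) \<phi> (Inl v) = Suc (depth (N - {Inl r}) \<phi> (Inr e))"
        using depth_parent[OF root pm, of "Inl v"] e(1) v \<open>Inl v \<in> N\<close> by simp
      ultimately show False by linarith
    qed
    moreover have "e' = e" if "e' \<in> E \<and> v \<in> e' - {petiole V E r e'}" for e'
      using up(3)[of e' v] that e(1) by auto
    ultimately show "\<exists>!e. e \<in> E \<and> v \<in> e - {petiole V E r e}"
      using e by (intro ex1I[of _ e]) blast+
  next
    show "wf {(petiole V E r e, v) |e v. e \<in> E \<and> v \<in> e - {petiole V E r e}}"
      by (rule wf_subset[OF wf_measure[of "\<lambda>v. depth (N - {Inl r}) \<phi> (Inl v)"]])
        (auto intro: lower)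
  qed (simp_all add: fin edge pet \<open>r \<in> V\<close>)
qed

text \<open>Sending each edge to its \<open>p e\<close> and each vertex to its unique edge is a
  parent map whose edges are the incidences, so the incidence graph is a tree.\<close>

lemma petiole_system_hypertree:
  assumes ps: "petiole_system V r E p"
  shows "hypertree V E" and "e \<in> E \<Longrightarrow> petiole V E r e = p e"
proof -
  define N where "N = incidence_vertices V E"
  define ed where "ed v = (THE e. e \<in> E \<and> v \<in> e - {p e})" for v
  define \<phi> where "\<phi> x = (case x of Inl v \<Rightarrow> Inr (ed v) | Inr e \<Rightarrow> Inl (p e))" for x :: "'a + 'a set"
  have fin: "finite V" and "r \<in> V" and wf: "wf {(p e, v) |e v. e \<in> E \<and> v \<in> e - {p e}}"
    and edge: "\<And>e. e \<in> E \<Longrightarrow> e \<subseteq> V \<and> p e \<in> e \<and> e - {p e} \<noteq> {} \<and> r \<notin> e - {p e}"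
    and ex1: "\<And>v. v \<in> V - {r} \<Longrightarrow> \<exists>!e. e \<in> E \<and> v \<in> e - {p e}"
    using ps by (auto simp: petiole_system_def)
  have ed: "ed v \<in> E" "v \<in> ed v - {p (ed v)}" if "v \<in> V - {r}" for v
    using theI'[OF ex1[OF that]] by (auto simp: ed_def)
  have ed_eq: "v \<in> V \<and> v \<noteq> r \<and> ed v = e" if "e \<in> E" "v \<in> e - {p e}" for v e
  proof -
    have v: "v \<in> V - {r}" using edge[OF that(1)] that(2) by auto
    with that show ?thesis unfolding ed_def using the1_equality[OF ex1[OF v]] by blast
  qed
  have wf': "wf ((\<lambda>v. (p (ed v), v)) ` (V - {r}))"
    by (rule wf_subset[OF wf]) (use ed in blast)
  define h where "h = depth (V - {r}) (\<lambda>v. p (ed v))"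
  have h: "h v = Suc (h (p (ed v)))" if "v \<in> V - {r}" for v
    unfolding h_def by (rule depth_step[OF wf' that])
  have root: "Inl r \<in> N"
    using \<open>r \<in> V\<close> by (auto simp: N_def incidence_vertices_def)
  have pm: "parent_map (N - {Inl r}) {Inl r} \<phi>"
  \<comment> \<open>Vertices get even heights, and an edge gets the odd height just above that of
    \<open>p e\<close>.\<close>
  proof (rule parent_mapI[where h = "case_sum (\<lambda>v. 2 * h v) (\<lambda>e. Suc (2 * h (p e)))"])
    fix x assume x: "x \<in> N - {Inl r}"
    show "\<phi> x \<in> N - {Inl r} \<union> {Inl r}"
      using x ed edge by (auto simp: N_def incidence_vertices_def \<phi>_def split: sum.splits)
    show "case_sum (\<lambda>v. 2 * h v) (\<lambda>e. Suc (2 * h (p e))) (\<phi> x) < case_sum (\<lambda>v. 2 * h v) (\<lambda>e. Suc (2 * h (p e))) x"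
    proof (cases x)
      case (Inl v)
      then have "v \<in> V - {r}" using x by (auto simp: N_def incidence_vertices_def)
      then show ?thesis using Inl h[of v] by (simp add: \<phi>_def)
    qed (simp add: \<phi>_def)
  qed
  have inc: "incidence_edges E = parent_edges (N - {Inl r}) \<phi>"
  proof (intro equalityI subsetI)
    fix c assume "c \<in> incidence_edges E"
    then obtain v e where c: "c = {Inl v, Inr e}" "e \<in> E" "v \<in> e"
      by (auto simp: incidence_edges_def)
    show "c \<in> parent_edges (N - {Inl r}) \<phi>"
    proof (cases "v = p e")
      case True
      then show ?thesis
        unfolding parent_edges_def using c
        by (intro image_eqI[of _ _ "Inr e"]) (auto simp: \<phi>_def N_def incidence_vertices_def)
    next
      case False
      then show ?thesis
        unfolding parent_edges_def using c ed_eq[of e v]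
        by (intro image_eqI[of _ _ "Inl v"]) (auto simp: \<phi>_def N_def incidence_vertices_def)
    qed
  next
    fix c assume "c \<in> parent_edges (N - {Inl r}) \<phi>"
    then obtain x where x: "x \<in> N" "x \<noteq> Inl r" "c = {x, \<phi> x}"
      by (auto simp: parent_edges_def)
    show "c \<in> incidence_edges E"
    proof (cases x)
      case (Inl v)
      then have v: "v \<in> V - {r}" using x by (auto simp: N_def incidence_vertices_def)
      show ?thesis
        using x Inl ed[OF v] by (auto simp: incidence_edges_def \<phi>_def)
    next
      case (Inr e)
      then have e: "e \<in> E" using x by (auto simp: N_def incidence_vertices_def)
      have "c = {Inl (p e), Inr e}" using x Inr by (auto simp: \<phi>_def)
      then show ?thesis
        using e edge[OF e] by (auto simp: incidence_edges_def)
    qed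
  qed
  have "E \<subseteq> Pow V" using edge by blast
  then have "finite N"
    using fin by (auto simp: N_def incidence_vertices_def dest: finite_subset)
  then have "is_tree N (incidence_edges E)"
    unfolding inc by (rule is_tree_parent_edges[OF root pm])
  moreover have "card e \<ge> 2" if e: "e \<in> E" for e
  proof -
    obtain v where v: "v \<in> e" "v \<noteq> p e" using edge[OF e] by blast
    have "card {v, p e} \<le> card e"
      using v edge[OF e] finite_subset[OF _ fin] by (intro card_mono) blast+
    then show ?thesis using v by simp
  qed
  ultimately show "hypertree V E"
    using fin \<open>r \<in> V\<close> edge by (auto simp: hypertree_def N_def)
  show "petiole V E r e = p e" if "e \<in> E" for e
  proof (rule petiole_eq[OF \<open>r \<in> V\<close> pm[unfolded N_def] inc[unfolded N_def] that])
    show "e \<subseteq> V" "p e \<in> e" using edge[OF that] by auto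
    show "\<phi> (Inr e) = Inl (p e)" by (simp add: \<phi>_def)
  qed
qed

section \<open>Decorated hypertrees as trees with marked vertices\<close>

text \<open>The common form of both structures: rooted hypertrees arise as the union over
  \<open>r\<close>, hollow ones from \<open>r = None\<close> with exactly one edge through
  it.\<close>

definition decorated_hypertrees :: "'a set \<Rightarrow> 'a \<Rightarrow> ('a set set \<times> ('a set \<Rightarrow> 'a \<times> 'a set set)) set" where
  "decorated_hypertrees V r = {(E, D). hypertree V E \<and> D \<in> decorations V E r}"

text \<open>\<open>r\<close> belongs to no decoration, so a vertex can be a child of
  \<open>r\<close> only as the root of a decoration. This is why all children of \<open>r\<close>
  are marked.\<close>

definition marked_maps :: "'a set \<Rightarrow> 'a \<Rightarrow> (('a \<Rightarrow> 'a) \<times> 'a set) set" where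
  "marked_maps V r =
     {(f, B). f \<in> parent_maps (V - {r}) {r} \<and> {v \<in> V - {r}. f v = r} \<subseteq> B \<and> B \<subseteq> V - {r}}"

text \<open>\<open>f\<close> sends the root of the tree decorating \<open>e\<close> to the petiole of \<open>e\<close> and every other vertex to
  its parent in that tree.\<close>

definition encodes ::
    "'a set \<Rightarrow> 'a \<Rightarrow> 'a set set \<times> ('a set \<Rightarrow> 'a \<times> 'a set set) \<Rightarrow> ('a \<Rightarrow> 'a) \<times> 'a set \<Rightarrow> bool" where
  "encodes V r = (\<lambda>(E, D) (f, B).
     B = (\<lambda>e. fst (D e)) ` E \<and>
     (\<forall>e\<in>E. f (fst (D e)) = petiole V E r e \<and>
        snd (D e) = parent_edges (e - {petiole V E r e} - {fst (D e)}) f \<and>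
        f ` (e - {petiole V E r e} - {fst (D e)}) \<subseteq> e - {petiole V E r e}))"

text \<open>\<open>top_vertex\<close> climbs to the nearest marked vertex; the clusters recover the edges without their
  petioles.\<close>

definition cluster :: "'a set \<Rightarrow> 'a \<Rightarrow> ('a \<Rightarrow> 'a) \<Rightarrow> 'a set \<Rightarrow> 'a \<Rightarrow> 'a set" where
  "cluster V r f B b = {v \<in> V - {r}. top_vertex (V - {r} - B) f v = b}"

section \<open>Existence and uniqueness of encodings in both directions\<close>

lemma decorated_hypertreesD:
  assumes "(E, D) \<in> decorated_hypertrees V r" and "e \<in> E"
  shows "fst (D e) \<in> e - {petiole V E r e}" and "is_tree (e - {petiole V E r e}) (snd (D e))"
  using assms by (auto simp: decorated_hypertrees_def decorations_def rooted_trees_on_def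
      dest!: PiE_mem[of _ _ _ e] split: prod.splits)

lemma encodes_marks: "encodes V r (E, D) (f, B) \<Longrightarrow> B = (\<lambda>e. fst (D e)) ` E"
  by (simp add: encodes_def)

lemma encodesD:
  assumes "encodes V r (E, D) (f, B)" and "e \<in> E"
  shows "f (fst (D e)) = petiole V E r e" and "fst (D e) \<in> B"
    and "snd (D e) = parent_edges (e - {petiole V E r e} - {fst (D e)}) f"
    and "v \<in> e - {petiole V E r e} - {fst (D e)} \<Longrightarrow> f v \<in> e - {petiole V E r e}"
  using assms unfolding encodes_def by blast+

lemma petiole_system_edge_exists:
  assumes "petiole_system V r E p" "v \<in> V - {r}"
  obtains e where "e \<in> E" "v \<in> e - {p e}"
proof -
  have "\<exists>!e. e \<in> E \<and> v \<in> e - {p e}"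
    using assms by (simp add: petiole_system_def)
  then show thesis using that by blast
qed

lemma petiole_system_edge_unique:
  assumes "petiole_system V r E p" "e \<in> E" "e' \<in> E" "v \<in> e - {p e}" "v \<in> e' - {p e'}"
  shows "e = e'"
proof -
  have "v \<in> V - {r}" using assms by (auto simp: petiole_system_def)
  then show ?thesis using assms by (auto simp: petiole_system_def)
qed

lemma parent_maps_wf: "f \<in> parent_maps S A \<Longrightarrow> S' \<subseteq> S \<Longrightarrow> wf ((\<lambda>v. (f v, v)) ` S')"
  by (auto simp: parent_maps_def parent_map_def elim!: wf_subset)

lemma marked_map_exists:
  assumes "r \<in> V" and DH: "(E, D) \<in> decorated_hypertrees V r"
  shows "\<exists>y\<in>marked_maps V r. encodes V r (E, D) y"
proof -
  let ?p = "petiole V E r"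
  define b where "b e = fst (D e)" for e
  have hyp: "hypertree V E" using DH by (simp add: decorated_hypertrees_def)
  then have ps: "petiole_system V r E ?p"
    by (rule hypertree_petiole_system[OF _ \<open>r \<in> V\<close>])
  have edge: "\<And>e. e \<in> E \<Longrightarrow> e \<subseteq> V \<and> ?p e \<in> e \<and> r \<notin> e - {?p e}"
    and ex1: "\<And>v. v \<in> V - {r} \<Longrightarrow> \<exists>!e. e \<in> E \<and> v \<in> e - {?p e}"
    and wf: "wf {(?p e, v) |e v. e \<in> E \<and> v \<in> e - {?p e}}"
    using ps by (auto simp: petiole_system_def)
  have b: "b e \<in> e - {?p e}" if "e \<in> E" for e
    using decorated_hypertreesD(1)[OF DH that] by (simp add: b_def)
  have "\<exists>g. parent_map (e - {?p e} - {b e}) {b e} g \<and> snd (D e) = parent_edges (e - {?p e} - {b e}) g"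
    if e: "e \<in> E" for e
    using is_tree_parent_map[OF decorated_hypertreesD(2)[OF DH e] b[OF e]] .
  then obtain g where g: "\<And>e. e \<in> E \<Longrightarrow> parent_map (e - {?p e} - {b e}) {b e} (g e)"
    and D: "\<And>e. e \<in> E \<Longrightarrow> snd (D e) = parent_edges (e - {?p e} - {b e}) (g e)"
    by metis
  define ed where "ed v = (THE e. e \<in> E \<and> v \<in> e - {?p e})" for v
  have ed: "ed v \<in> E" "v \<in> ed v - {?p (ed v)}" if "v \<in> V - {r}" for v
    using theI'[OF ex1[OF that]] by (auto simp: ed_def)
  have ed_eq: "v \<in> V - {r}" "ed v = e" if "e \<in> E" "v \<in> e - {?p e}" for v e
  proof -
    show v: "v \<in> V - {r}" using edge[OF that(1)] that(2) by auto
    show "ed v = e" unfolding ed_def using that the1_equality[OF ex1[OF v]] by blast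
  qed
  define f where "f v = (if v \<in> V - {r} then if v = b (ed v) then ?p (ed v) else g (ed v) v else undefined)" for v
  have f_top: "f (b e) = ?p e" if "e \<in> E" for e
    using ed_eq[OF that b[OF that]] by (simp add: f_def)
  have f_in: "f v = g e v" "f v \<in> e - {?p e}" if "e \<in> E" "v \<in> e - {?p e} - {b e}" for e v
  proof -
    show eq: "f v = g e v"
      using ed_eq[of e v] that by (simp add: f_def)
    show "f v \<in> e - {?p e}"
      unfolding eq using parent_map_mem[OF g[OF that(1)] that(2)] b[OF that(1)] by auto
  qed
  have "wf ((\<lambda>v. (?p (ed v), v)) ` (V - {r}))"
    by (rule wf_subset[OF wf]) (use ed in blast)
  note h = depth_step[OF this]
  let ?h = "depth (V - {r}) (\<lambda>v. ?p (ed v))"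
  let ?k = "\<lambda>v. depth (ed v - {?p (ed v)} - {b (ed v)}) (g (ed v)) v"
  \<comment> \<open>Lexicographic descent: the step from the root of a decoration to the petiole
    lowers \<open>?h\<close>, the number of edges to cross on the way to \<open>r\<close>; a step
    inside a decoration keeps \<open>?h\<close> and lowers the depth \<open>?k\<close>
    there.\<close>
  have step: "(f v, v) \<in> measures [?h, ?k]" if v: "v \<in> V - {r}" for v
  proof (cases "v = b (ed v)")
    case True
    then have "f v = ?p (ed v)" using v by (simp add: f_def)
    then show ?thesis using h[OF v] by simp
  next
    case False
    note e = ed[OF v]
    have v': "v \<in> ed v - {?p (ed v)} - {b (ed v)}" using e False by blast
    have fv: "f v \<in> V - {r}" "ed (f v) = ed v"
      using ed_eq[OF e(1) f_in(2)[OF e(1) v']] by auto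
    have "?k v = Suc (?k (f v))"
      using depth_step[of "g (ed v)", OF _ v'] g[OF e(1)] f_in(1)[OF e(1) v'] fv
      by (simp add: parent_map_def)
    then show ?thesis using h[OF v] h[OF fv(1)] fv by simp
  qed
  have f_mem: "f v \<in> V" if v: "v \<in> V - {r}" for v
    using v ed[OF v] edge[OF ed(1)[OF v]] f_in(2)[OF ed(1)[OF v], of v] f_top[OF ed(1)[OF v]]
    by (cases "v = b (ed v)") auto
  have "wf ((\<lambda>v. (f v, v)) ` (V - {r}))"
    by (rule wf_subset[OF wf_measures[of "[?h, ?k]"]]) (use step in blast)
  then have "parent_map (V - {r}) {r} f"
    using f_mem by (auto simp: parent_map_def)
  moreover have "f \<in> V - {r} \<rightarrow>\<^sub>E V - {r} \<union> {r}"
  proof (rule PiE_I)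
    show "f v = undefined" if "v \<notin> V - {r}" for v
      unfolding f_def by (rule if_not_P[OF that])
  qed (use f_mem in auto)
  ultimately have "f \<in> parent_maps (V - {r}) {r}"
    by (simp add: parent_maps_def)
  moreover have "v \<in> b ` E" if v: "v \<in> V - {r}" "f v = r" for v
  proof (rule ccontr)
    assume "v \<notin> b ` E"
    then have "f v \<in> ed v - {?p (ed v)}"
      using ed[OF v(1)] by (intro f_in(2)) auto
    then show False using edge[OF ed(1)[OF v(1)]] v(2) by blast
  qed
  moreover have "b ` E \<subseteq> V - {r}"
    using ed_eq(1) b by blast
  ultimately have "(f, b ` E) \<in> marked_maps V r"
    by (auto simp: marked_maps_def)
  moreover have "snd (D e) = parent_edges (e - {?p e} - {b e}) f" if "e \<in> E" for e
    unfolding D[OF that] parent_edges_def using f_in(1)[OF that] by (intro image_cong) auto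
  then have "encodes V r (E, D) (f, b ` E)"
    unfolding encodes_def prod.case b_def[symmetric]
    by (intro conjI ballI image_subsetI refl f_top f_in(2)) simp_all
  ultimately show ?thesis by blast
qed

text \<open>Every vertex other than \<open>r\<close> lies in exactly one decoration. At the root of
  that decoration the parent must be the petiole; elsewhere the edges of the decoration force it by
  \<open>parent_edges_inj\<close>.\<close>

lemma encodes_marked_map_unique:
  assumes "r \<in> V" and DH: "(E, D) \<in> decorated_hypertrees V r"
    and fB: "(f, B) \<in> marked_maps V r" and gC: "(g, C) \<in> marked_maps V r"
    and enc: "encodes V r (E, D) (f, B)" "encodes V r (E, D) (g, C)"
  shows "(f, B) = (g, C)"
proof -
  let ?p = "petiole V E r"
  have ps: "petiole_system V r E ?p"
    using DH by (intro hypertree_petiole_system[OF _ \<open>r \<in> V\<close>]) (simp add: decorated_hypertrees_def)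
  have pm: "f \<in> parent_maps (V - {r}) {r}" "g \<in> parent_maps (V - {r}) {r}"
    using fB gC by (auto simp: marked_maps_def)
  have "f v = g v" if v: "v \<in> V - {r}" for v
  proof -
    obtain e where e: "e \<in> E" "v \<in> e - {?p e}"
      by (rule petiole_system_edge_exists[OF ps v])
    show ?thesis
    proof (cases "v = fst (D e)")
      case True
      then show ?thesis using encodesD(1)[OF enc(1) e(1)] encodesD(1)[OF enc(2) e(1)] by simp
    next
      case False
      have sub: "e - {?p e} - {fst (D e)} \<subseteq> V - {r}"
        using ps e by (auto simp: petiole_system_def)
      have map: "parent_map (e - {?p e} - {fst (D e)}) {fst (D e)} f'"
        if "f' \<in> parent_maps (V - {r}) {r}" "encodes V r (E, D) (f', B')" for f' B'
        using parent_maps_wf[OF that(1) sub] encodesD(4)[OF that(2) e(1)] by (auto simp: parent_map_def)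
      show ?thesis
        by (rule parent_edges_inj[OF decorated_hypertreesD(1)[OF DH e(1)] map[OF pm(1) enc(1)] map[OF pm(2) enc(2)]])
          (use encodesD(3)[OF enc(1) e(1)] encodesD(3)[OF enc(2) e(1)] e False in auto)
    qed
  qed
  then have "f = g"
    using pm by (auto simp: parent_maps_def intro: PiE_ext)
  moreover have "B = C"
    using encodes_marks[OF enc(1)] encodes_marks[OF enc(2)] by simp
  ultimately show ?thesis by simp
qed

text \<open>Starting in \<open>e\<close> away from its petiole, \<open>f\<close> stays there until
  it meets the root of the decoration, the only marked vertex in that set. The first mark above a
  vertex thus identifies its edge.\<close>

lemma encodes_cluster:
  assumes "r \<in> V" and DH: "(E, D) \<in> decorated_hypertrees V r"
    and fB: "(f, B) \<in> marked_maps V r" and enc: "encodes V r (E, D) (f, B)" and "e \<in> E"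
  shows "e - {petiole V E r e} = cluster V r f B (fst (D e))"
proof -
  let ?p = "petiole V E r"
  have ps: "petiole_system V r E ?p"
    using DH by (intro hypertree_petiole_system[OF _ \<open>r \<in> V\<close>]) (simp add: decorated_hypertrees_def)
  note B = encodes_marks[OF enc]
  have wf: "wf ((\<lambda>v. (f v, v)) ` (V - {r} - B))"
    using fB by (auto simp: marked_maps_def intro: parent_maps_wf)
  have in_S: "v \<in> V - {r}" if "e \<in> E" "v \<in> e - {?p e}" for v e
    using ps that by (auto simp: petiole_system_def)
  have top: "\<forall>e\<in>E. v \<in> e - {?p e} \<longrightarrow> top_vertex (V - {r} - B) f v = fst (D e)" for v
    using wf
  proof (induction v rule: parent_map_induct)
    case (outside v)
    show ?case
    proof (intro ballI impI)
      fix e assume e: "e \<in> E" "v \<in> e - {?p e}"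
      then obtain e' where e': "e' \<in> E" "v = fst (D e')"
        using outside in_S[OF e] B by auto
      then have "e' = e"
        using petiole_system_edge_unique[OF ps e'(1) e(1) _ e(2)] decorated_hypertreesD(1)[OF DH e'(1)]
        by simp
      then show "top_vertex (V - {r} - B) f v = fst (D e)"
        using e' outside by (simp add: top_vertex_outside)
    qed
  next
    case (step v)
    show ?case
    proof (intro ballI impI)
      fix e assume e: "e \<in> E" "v \<in> e - {?p e}"
      moreover have "v \<noteq> fst (D e)"
        using step(1) encodesD(2)[OF enc e(1)] by auto
      ultimately have "f v \<in> e - {?p e}"
        by (intro encodesD(4)[OF enc]) auto
      then show "top_vertex (V - {r} - B) f v = fst (D e)"
        using step e top_vertex_step[OF wf step(1)] by auto
    qed
  qed
  show ?thesis
  proof (intro equalityI subsetI)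
    fix v assume v: "v \<in> cluster V r f B (fst (D e))"
    then have "v \<in> V - {r}" by (simp add: cluster_def)
    then obtain e' where e': "e' \<in> E" "v \<in> e' - {?p e'}"
      by (rule petiole_system_edge_exists[OF ps])
    then have eq: "fst (D e') = fst (D e)"
      using top[of v] v by (auto simp: cluster_def)
    have "e' = e"
      using petiole_system_edge_unique[OF ps e'(1) \<open>e \<in> E\<close> decorated_hypertreesD(1)[OF DH e'(1)]]
        decorated_hypertreesD(1)[OF DH \<open>e \<in> E\<close>] by (simp add: eq)
    then show "v \<in> e - {?p e}" using e' by simp
  qed (use top in_S \<open>e \<in> E\<close> in \<open>auto simp: cluster_def\<close>)
qed

lemma cluster_mark: "(f, B) \<in> marked_maps V r \<Longrightarrow> b \<in> B \<Longrightarrow> b \<in> cluster V r f B b"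
  by (auto simp: cluster_def marked_maps_def top_vertex_outside)

lemma cluster_unique: "v \<in> cluster V r f B b \<Longrightarrow> v \<in> cluster V r f B b' \<Longrightarrow> b = b'"
  by (simp add: cluster_def)

text \<open>Each edge is a cluster completed by the parent of its mark, so the edges depend on
  \<open>(f, B)\<close> alone. A mark lies in its own cluster and in no other, which recovers the
  root of the decoration.\<close>

lemma encodes_decorated_hypertree_unique:
  assumes "r \<in> V" and DH: "(E, D) \<in> decorated_hypertrees V r" "(E', D') \<in> decorated_hypertrees V r"
    and fB: "(f, B) \<in> marked_maps V r"
    and enc: "encodes V r (E, D) (f, B)" "encodes V r (E', D') (f, B)"
  shows "(E, D) = (E', D')"
proof -
  have edges: "E = (\<lambda>b. insert (f b) (cluster V r f B b)) ` B"
    if DH: "(E, D) \<in> decorated_hypertrees V r" and enc: "encodes V r (E, D) (f, B)" for E D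
  proof -
    have "insert (f (fst (D e))) (cluster V r f B (fst (D e))) = e" if "e \<in> E" for e
    proof -
      have "petiole V E r e \<in> e"
        using hypertree_petiole_system[OF _ \<open>r \<in> V\<close>, of E] DH that
        by (auto simp: decorated_hypertrees_def petiole_system_def)
      then show ?thesis
        using encodes_cluster[OF \<open>r \<in> V\<close> DH fB enc that] encodesD(1)[OF enc that] by auto
    qed
    then have "E = (\<lambda>e. insert (f (fst (D e))) (cluster V r f B (fst (D e)))) ` E"
      by simp
    also have "\<dots> = (\<lambda>b. insert (f b) (cluster V r f B b)) ` B"
      unfolding encodes_marks[OF enc] by (simp add: image_image)
    finally show ?thesis .
  qed
  have E: "E = E'"
    using edges[OF DH(1) enc(1)] edges[OF DH(2) enc(2)] by simp
  have "D e = D' e" if e: "e \<in> E" for e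
  proof -
    have e': "e \<in> E'" using e E by simp
    have "fst (D e) \<in> cluster V r f B (fst (D e))"
      by (rule cluster_mark[OF fB encodesD(2)[OF enc(1) e]])
    moreover have "cluster V r f B (fst (D e)) = cluster V r f B (fst (D' e))"
      using encodes_cluster[OF \<open>r \<in> V\<close> DH(1) fB enc(1) e] encodes_cluster[OF \<open>r \<in> V\<close> DH(2) fB enc(2) e'] E
      by simp
    ultimately have "fst (D e) = fst (D' e)"
      by (auto intro: cluster_unique)
    moreover from this have "snd (D e) = snd (D' e)"
      using encodesD(3)[OF enc(1) e] encodesD(3)[OF enc(2) e'] E by simp
    ultimately show ?thesis by (rule prod_eqI)
  qed
  moreover have "D \<in> extensional E" "D' \<in> extensional E"
    using DH unfolding E by (simp_all add: decorated_hypertrees_def decorations_def PiE_def)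
  ultimately have "D = D'" by (auto intro: extensionalityI)
  with E show ?thesis by simp
qed

text \<open>For clusters this says that every vertex is at least as deep as its mark, hence strictly
  deeper than the intended petiole, the parent of the mark.\<close>

lemma depth_top_vertex_le:
  assumes wf: "wf ((\<lambda>v. (f v, v)) ` S)" and "T \<subseteq> S"
  shows "depth S f (top_vertex T f v) \<le> depth S f v"
proof -
  have wf': "wf ((\<lambda>v. (f v, v)) ` T)"
    by (rule wf_subset[OF wf]) (use assms(2) in blast)
  then show ?thesis
  proof (induction v rule: parent_map_induct)
    case (step v)
    then show ?case
      using depth_step[OF wf, of v] top_vertex_step[OF wf' step(1)] assms(2) by auto
  qed (simp add: top_vertex_outside)
qed

lemma decorated_hypertree_exists:
  assumes "finite V" "r \<in> V" and fB: "(f, B) \<in> marked_maps V r"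
  shows "\<exists>x\<in>decorated_hypertrees V r. encodes V r x (f, B)"
proof -
  let ?S = "V - {r}"
  let ?C = "cluster V r f B"
  let ?d = "depth ?S f"
  define eb where "eb b = insert (f b) (?C b)" for b
  define E where "E = eb ` B"
  define \<beta> where "\<beta> = inv_into B eb"
  define D where "D = restrict (\<lambda>e. (\<beta> e, parent_edges (?C (\<beta> e) - {\<beta> e}) f)) E"
  have f: "f \<in> parent_maps ?S {r}" and B: "{v \<in> ?S. f v = r} \<subseteq> B" "B \<subseteq> ?S"
    using fB by (auto simp: marked_maps_def)
  have mem: "f v \<in> V" if "v \<in> ?S" for v
    using f that parent_map_mem[of ?S "{r}" f v] \<open>r \<in> V\<close> by (auto simp: parent_maps_def)
  have wf: "wf ((\<lambda>v. (f v, v)) ` ?S)" and wf\<^sub>B: "wf ((\<lambda>v. (f v, v)) ` (?S - B))"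
    using f by (auto intro: parent_maps_wf)
  have d_le: "?d b \<le> ?d v" if "v \<in> ?C b" for v b
    using depth_top_vertex_le[OF wf, of "?S - B" v] that by (auto simp: cluster_def)
  have d_f: "?d b = Suc (?d (f b))" if "b \<in> B" for b
    using depth_step[OF wf, of b] B that by blast
  have d_less: "?d (f b) < ?d v" if "b \<in> B" "v \<in> ?C b" for b v
    using d_f[OF that(1)] d_le[OF that(2)] by simp
  have C_up: "f v \<in> ?C b" if "v \<in> ?C b" "v \<notin> B" for v b
  proof -
    have v: "v \<in> ?S - B" using that by (auto simp: cluster_def)
    then show ?thesis
      using that mem B top_vertex_step[OF wf\<^sub>B v] by (auto simp: cluster_def)
  qed
  have C_root: "v = b" if "v \<in> ?C b" "v \<in> B" for v b
    using that by (auto simp: cluster_def top_vertex_outside)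
  have C_cover: "v \<in> ?S \<longrightarrow> (\<exists>b\<in>B. v \<in> ?C b)" for v
    using wf\<^sub>B
  proof (induction v rule: parent_map_induct)
    case (outside v)
    then show ?case using cluster_mark[OF fB] by blast
  next
    case (step v)
    then have "f v \<in> ?S" using mem[of v] B by blast
    then show ?case
      using step top_vertex_step[OF wf\<^sub>B step(1)] by (auto simp: cluster_def)
  qed
  have eb_diff: "eb b - {f b} = ?C b" if "b \<in> B" for b
    using d_less[OF that, of "f b"] by (auto simp: eb_def)
  \<comment> \<open>If two marks with different parents gave the same set, each parent would lie in
    the cluster of the other mark and be strictly deeper than the other parent. Equal parents leave
    equal clusters, and a cluster contains only one mark.\<close>
  have inj: "inj_on eb B"
  proof (rule inj_onI)
    fix b b' assume b: "b \<in> B" "b' \<in> B" and eq: "eb b = eb b'"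
    have "f b = f b'"
    proof (rule ccontr)
      assume ne: "f b \<noteq> f b'"
      have "f b \<in> eb b'" unfolding eq[symmetric] by (simp add: eb_def)
      moreover have "f b' \<in> eb b" unfolding eq by (simp add: eb_def)
      ultimately have "f b \<in> ?C b'" "f b' \<in> ?C b" using ne by (auto simp: eb_def)
      then show False using d_less[OF b(2), of "f b"] d_less[OF b(1), of "f b'"] by simp
    qed
    then have "b \<in> ?C b'"
      using eb_diff[OF b(1)] eb_diff[OF b(2)] eq cluster_mark[OF fB b(1)] by simp
    then show "b = b'" using C_root b by blast
  qed
  have \<beta>: "\<beta> (eb b) = b" if "b \<in> B" for b
    unfolding \<beta>_def by (rule inv_into_f_f[OF inj that])
  have ps: "petiole_system V r E (\<lambda>e. f (\<beta> e))"
    unfolding petiole_system_def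
  proof (intro conjI ballI)
    fix e assume "e \<in> E"
    then obtain b where b: "b \<in> B" "e = eb b" by (auto simp: E_def)
    show "e \<subseteq> V" using b B mem by (auto simp: eb_def cluster_def)
    show "f (\<beta> e) \<in> e" using \<beta>[OF b(1)] b(2) by (simp add: eb_def)
    show "e - {f (\<beta> e)} \<noteq> {}" using \<beta>[OF b(1)] eb_diff[OF b(1)] cluster_mark[OF fB b(1)] b(2) by auto
    show "r \<notin> e - {f (\<beta> e)}" using \<beta>[OF b(1)] eb_diff[OF b(1)] b(2) by (simp add: cluster_def)
  next
    fix v assume "v \<in> V - {r}"
    then obtain b where b: "b \<in> B" "v \<in> ?C b" using C_cover by blast
    show "\<exists>!e. e \<in> E \<and> v \<in> e - {f (\<beta> e)}"
    proof (rule ex1I[of _ "eb b"])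
      show "eb b \<in> E \<and> v \<in> eb b - {f (\<beta> (eb b))}"
        unfolding \<beta>[OF b(1)] eb_diff[OF b(1)] using b by (simp add: E_def)
      fix e assume e: "e \<in> E \<and> v \<in> e - {f (\<beta> e)}"
      then obtain b' where b': "b' \<in> B" "e = eb b'" by (auto simp: E_def)
      have "v \<in> ?C b'" using e unfolding b'(2) \<beta>[OF b'(1)] eb_diff[OF b'(1)] by simp
      then show "e = eb b" using b b' by (auto simp: cluster_def)
    qed
  next
    have "(f (\<beta> e), v) \<in> measure ?d" if ev: "e \<in> E" "v \<in> e - {f (\<beta> e)}" for e v
    proof -
      obtain b where b: "b \<in> B" "e = eb b" using ev(1) by (auto simp: E_def)
      have "v \<in> ?C b" using ev(2) unfolding b(2) \<beta>[OF b(1)] eb_diff[OF b(1)] .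
      then show ?thesis using d_less[OF b(1), of v] b \<beta> by simp
    qed
    then show "wf {(f (\<beta> e), v) |e v. e \<in> E \<and> v \<in> e - {f (\<beta> e)}}"
      by (intro wf_subset[OF wf_measure[of ?d]]) auto
  qed (use assms in auto)
  note pet = petiole_system_hypertree(2)[OF ps]
  have cl: "e - {petiole V E r e} = ?C (\<beta> e)" "\<beta> e \<in> B" if "e \<in> E" for e
  proof -
    obtain b where b: "b \<in> B" "e = eb b" using \<open>e \<in> E\<close> by (auto simp: E_def)
    show "e - {petiole V E r e} = ?C (\<beta> e)"
      unfolding pet[OF that] unfolding b(2) \<beta>[OF b(1)] by (rule eb_diff[OF b(1)])
    show "\<beta> e \<in> B" unfolding b(2) \<beta>[OF b(1)] by (rule b(1))
  qed
  have "D \<in> decorations V E r"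
    unfolding decorations_def
  proof (rule PiE_I)
    fix e assume e: "e \<in> E"
    note b = cl(2)[OF e]
    have "parent_map (?C (\<beta> e) - {\<beta> e}) {\<beta> e} f"
      unfolding parent_map_def
    proof
      show "\<forall>v\<in>?C (\<beta> e) - {\<beta> e}. f v \<in> ?C (\<beta> e) - {\<beta> e} \<union> {\<beta> e}"
        using C_up C_root by blast
      show "wf ((\<lambda>v. (f v, v)) ` (?C (\<beta> e) - {\<beta> e}))"
        by (rule parent_maps_wf[OF f]) (auto simp: cluster_def)
    qed
    moreover have "finite (?C (\<beta> e))" using \<open>finite V\<close> by (simp add: cluster_def)
    ultimately show "D e \<in> rooted_trees_on (e - {petiole V E r e})"
      unfolding cl(1)[OF e] using is_tree_parent_edges[OF cluster_mark[OF fB b]] cluster_mark[OF fB b] e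
      by (simp add: D_def rooted_trees_on_def)
  qed (simp add: D_def)
  then have "(E, D) \<in> decorated_hypertrees V r"
    using petiole_system_hypertree(1)[OF ps] by (simp add: decorated_hypertrees_def)
  moreover have "encodes V r (E, D) (f, B)"
  proof -
    have "(\<lambda>e. fst (D e)) ` E = B"
      by (auto simp: D_def E_def \<beta> image_image)
    moreover have "f v \<in> ?C (\<beta> e)" if "e \<in> E" "v \<in> ?C (\<beta> e) - {\<beta> e}" for e v
      using that C_up C_root by blast
    ultimately show ?thesis
      using cl(1) pet by (auto simp: encodes_def D_def)
  qed
  ultimately show ?thesis by blast
qed

section \<open>Statistics preserved by the encoding\<close>

lemma encodes_bij_betw:
  assumes "r \<in> V" and DH: "(E, D) \<in> decorated_hypertrees V r" and enc: "encodes V r (E, D) (f, B)"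
  shows "bij_betw (\<lambda>e. fst (D e)) E B"
proof (rule bij_betw_imageI)
  have ps: "petiole_system V r E (petiole V E r)"
    using DH by (intro hypertree_petiole_system[OF _ \<open>r \<in> V\<close>]) (simp add: decorated_hypertrees_def)
  show "inj_on (\<lambda>e. fst (D e)) E"
  proof (rule inj_onI)
    fix e e' assume e: "e \<in> E" "e' \<in> E" "fst (D e) = fst (D e')"
    show "e = e'"
      by (rule petiole_system_edge_unique[OF ps e(1,2) decorated_hypertreesD(1)[OF DH e(1)]])
        (use decorated_hypertreesD(1)[OF DH e(2)] e(3) in simp)
  qed
  show "(\<lambda>e. fst (D e)) ` E = B"
    using encodes_marks[OF enc] by simp
qed

lemma encodes_prod:
  assumes "r \<in> V" and "(E, D) \<in> decorated_hypertrees V r" and enc: "encodes V r (E, D) (f, B)"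
  shows "(\<Prod>e\<in>E. w (petiole V E r e)) = (\<Prod>v\<in>B. w (f v))"
proof -
  have "(\<Prod>e\<in>E. w (petiole V E r e)) = (\<Prod>e\<in>E. w (f (fst (D e))))"
    using encodesD(1)[OF enc] by simp
  also have "\<dots> = (\<Prod>v\<in>B. w (f v))"
    by (rule prod.reindex_bij_betw[OF encodes_bij_betw[OF assms]])
  finally show ?thesis .
qed

text \<open>An edge can contain \<open>r\<close> only as its petiole. The condition on the gap
  thereby becomes a condition on the number of children of \<open>r\<close>.\<close>

lemma encodes_card_root_edges:
  assumes "r \<in> V" and DH: "(E, D) \<in> decorated_hypertrees V r"
    and fB: "(f, B) \<in> marked_maps V r" and enc: "encodes V r (E, D) (f, B)"
  shows "card {e \<in> E. r \<in> e} = card {v \<in> V - {r}. f v = r}"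
proof (rule bij_betw_same_card)
  have ps: "petiole_system V r E (petiole V E r)"
    using DH by (intro hypertree_petiole_system[OF _ \<open>r \<in> V\<close>]) (simp add: decorated_hypertrees_def)
  have iff: "r \<in> e \<longleftrightarrow> f (fst (D e)) = r" if "e \<in> E" for e
  proof -
    have "petiole V E r e \<in> e" "r \<notin> e - {petiole V E r e}"
      using ps that by (simp_all add: petiole_system_def)
    then show ?thesis using encodesD(1)[OF enc that] by auto
  qed
  have "{v \<in> V - {r}. f v = r} = {v \<in> B. f v = r}"
    using fB by (auto simp: marked_maps_def)
  also have "\<dots> = (\<lambda>e. fst (D e)) ` {e \<in> E. r \<in> e}"
    unfolding encodes_marks[OF enc] using iff by blast
  finally show "bij_betw (\<lambda>e. fst (D e)) {e \<in> E. r \<in> e} {v \<in> V - {r}. f v = r}"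
    by (intro bij_betw_subset[OF encodes_bij_betw[OF assms(1,2) enc]]) auto
qed

text \<open>\<open>h\<close> is chosen from the relation \<open>encodes\<close>. Uniqueness of the
  hypertree makes it injective; uniqueness of the marked map turns the encoded hypertree from
  \<open>decorated_hypertree_exists\<close> into a preimage under \<open>h\<close>.\<close>

lemma encoding_bij_betw:
  assumes "finite V" "r \<in> V"
  obtains h where "bij_betw h (decorated_hypertrees V r) (marked_maps V r)"
    and "\<And>x. x \<in> decorated_hypertrees V r \<Longrightarrow> encodes V r x (h x)"
proof -
  have "\<forall>x\<in>decorated_hypertrees V r. \<exists>y. y \<in> marked_maps V r \<and> encodes V r x y"
    using marked_map_exists[OF \<open>r \<in> V\<close>] by fast
  from bchoice[OF this] obtain h where
    h: "\<And>x. x \<in> decorated_hypertrees V r \<Longrightarrow> h x \<in> marked_maps V r \<and> encodes V r x (h x)"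
    by blast
  have "inj_on h (decorated_hypertrees V r)"
  proof (rule inj_onI)
    fix x x' assume x: "x \<in> decorated_hypertrees V r" "x' \<in> decorated_hypertrees V r" "h x = h x'"
    obtain E D E' D' f B where "x = (E, D)" "x' = (E', D')" "h x = (f, B)" by (metis surj_pair)
    then show "x = x'"
      using encodes_decorated_hypertree_unique[OF \<open>r \<in> V\<close>, of E D E' D' f B] h[OF x(1)] h[OF x(2)] x by auto
  qed
  moreover have "h ` decorated_hypertrees V r = marked_maps V r"
  proof (intro equalityI subsetI)
    fix y assume y: "y \<in> marked_maps V r"
    obtain f B where fB: "y = (f, B)" by (cases y)
    obtain x where x: "x \<in> decorated_hypertrees V r" "encodes V r x (f, B)"
      using decorated_hypertree_exists[OF assms] y fB by blast
    obtain E D g C where "x = (E, D)" "h x = (g, C)" by (metis surj_pair)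
    then have "h x = y"
      using encodes_marked_map_unique[OF \<open>r \<in> V\<close>, of E D f B g C] h[OF x(1)] x y fB by auto
    then show "y \<in> h ` decorated_hypertrees V r" using x(1) by blast
  qed (use h in blast)
  ultimately show thesis
    using that h by (auto simp: bij_betw_def)
qed

section \<open>Weighted sums over decorated hypertrees\<close>

lemma finite_marked_maps: "finite V \<Longrightarrow> finite (marked_maps V r)"
  by (rule finite_subset[of _ "parent_maps (V - {r}) {r} \<times> Pow (V - {r})"])
    (auto simp: marked_maps_def finite_parent_maps)

lemma finite_decorated_hypertrees:
  assumes "finite V" "r \<in> V"
  shows "finite (decorated_hypertrees V r)"
  using encoding_bij_betw[OF assms] finite_marked_maps[OF assms(1)] by (metis bij_betw_finite)

text \<open>\<open>P\<close> is constantly true for rooted hypertrees and \<open>k = 1\<close> for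
  hollow ones. The number it tests depends on \<open>f\<close> but not on the marks, so it passes
  through the summation over \<open>B\<close>.\<close>

theorem sum_decorated_hypertrees:
  fixes w :: "'a \<Rightarrow> 'b::comm_semiring_1"
  assumes "finite V" "r \<in> V"
  shows "(\<Sum>(E, D) | (E, D) \<in> decorated_hypertrees V r \<and> P (card {e \<in> E. r \<in> e}).
            \<Prod>e\<in>E. w (petiole V E r e)) =
         (\<Sum>f | f \<in> parent_maps (V - {r}) {r} \<and> P (card {v \<in> V - {r}. f v = r}).
            \<Prod>v\<in>V - {r}. w (f v) + (if f v = r then 0 else 1))"
proof -
  let ?S = "V - {r}"
  let ?F = "{f \<in> parent_maps ?S {r}. P (card {v \<in> ?S. f v = r})}"
  let ?X = "{x \<in> decorated_hypertrees V r. P (card {e \<in> fst x. r \<in> e})}"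
  let ?Y = "SIGMA f:?F. {B \<in> Pow ?S. {v \<in> ?S. f v = r} \<subseteq> B}"
  obtain h where bij: "bij_betw h (decorated_hypertrees V r) (marked_maps V r)"
    and enc: "\<And>x. x \<in> decorated_hypertrees V r \<Longrightarrow> encodes V r x (h x)"
    using encoding_bij_betw[OF assms] by blast
  have Y: "?Y = {y \<in> marked_maps V r. P (card {v \<in> ?S. fst y v = r})}"
    by (auto simp: marked_maps_def)
  have h: "h x \<in> marked_maps V r" if "x \<in> decorated_hypertrees V r" for x
    using bij that by (auto simp: bij_betw_def)
  have P_iff: "P (card {e \<in> fst x. r \<in> e}) \<longleftrightarrow> P (card {v \<in> ?S. fst (h x) v = r})"
    if "x \<in> decorated_hypertrees V r" for x
    using encodes_card_root_edges[OF assms(2), of "fst x" "snd x" "fst (h x)" "snd (h x)"] that h[OF that] enc[OF that]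
    by simp
  have prod: "(\<Prod>e\<in>fst x. w (petiole V (fst x) r e)) = (\<Prod>v\<in>snd (h x). w (fst (h x) v))"
    if "x \<in> decorated_hypertrees V r" for x
    using encodes_prod[OF assms(2), of "fst x" "snd x" "fst (h x)" "snd (h x)" w] that enc[OF that] by simp
  have "bij_betw h ?X ?Y"
    unfolding Y
  proof (rule bij_betw_subset[OF bij])
    show "h ` ?X = {y \<in> marked_maps V r. P (card {v \<in> ?S. fst y v = r})}"
    proof (intro equalityI subsetI)
      fix y assume "y \<in> h ` ?X"
      then obtain x where "y = h x" "x \<in> decorated_hypertrees V r" "P (card {e \<in> fst x. r \<in> e})"
        by blast
      then show "y \<in> {y \<in> marked_maps V r. P (card {v \<in> ?S. fst y v = r})}"
        using P_iff[of x] h[of x] by simp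
    next
      fix y assume y: "y \<in> {y \<in> marked_maps V r. P (card {v \<in> ?S. fst y v = r})}"
      then obtain x where "y = h x" "x \<in> decorated_hypertrees V r"
        using bij_betw_imp_surj_on[OF bij] by blast
      then show "y \<in> h ` ?X"
        using P_iff[of x] y by blast
    qed
  qed auto
  have "(\<Sum>(E, D) | (E, D) \<in> decorated_hypertrees V r \<and> P (card {e \<in> E. r \<in> e}).
            \<Prod>e\<in>E. w (petiole V E r e)) = (\<Sum>x\<in>?X. \<Prod>e\<in>fst x. w (petiole V (fst x) r e))"
    by (rule sum.cong) auto
  also have "\<dots> = (\<Sum>x\<in>?X. (\<lambda>(f, B). \<Prod>v\<in>B. w (f v)) (h x))"
    using prod by (intro sum.cong) (auto simp: case_prod_beta)
  also have "\<dots> = (\<Sum>(f, B)\<in>?Y. \<Prod>v\<in>B. w (f v))"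
    by (rule sum.reindex_bij_betw) fact
  also have "\<dots> = (\<Sum>f\<in>?F. \<Sum>B | B \<in> Pow ?S \<and> {v \<in> ?S. f v = r} \<subseteq> B. \<Prod>v\<in>B. w (f v))"
    using assms(1) by (intro sum.Sigma[symmetric]) (auto simp: finite_parent_maps)
  also have "\<dots> = (\<Sum>f\<in>?F. \<Prod>v\<in>?S. w (f v) + (if f v = r then 0 else 1))"
  proof (rule sum.cong[OF refl])
    fix f
    \<comment> \<open>When the product is expanded, \<open>B\<close> is the set of vertices whose
      factor \<open>w (f v)\<close> is selected. A child of \<open>r\<close> outside
      \<open>B\<close> contributes 0, so only admissible sets of marks survive.\<close>
    have "(\<Prod>v\<in>?S. w (f v) + (if f v = r then 0 else 1)) =
        (\<Sum>B\<in>Pow ?S. (\<Prod>v\<in>B. w (f v)) * (\<Prod>v\<in>?S - B. if f v = r then 0 else 1))"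
      using assms(1) by (intro prod_add) simp
    also have "\<dots> = (\<Sum>B | B \<in> Pow ?S \<and> {v \<in> ?S. f v = r} \<subseteq> B. \<Prod>v\<in>B. w (f v))"
    proof (rule sum.mono_neutral_cong_right)
      show "\<forall>B\<in>Pow ?S - {B. B \<in> Pow ?S \<and> {v \<in> ?S. f v = r} \<subseteq> B}.
          (\<Prod>v\<in>B. w (f v)) * (\<Prod>v\<in>?S - B. if f v = r then 0 else 1) = 0"
      proof
        fix B assume "B \<in> Pow ?S - {B. B \<in> Pow ?S \<and> {v \<in> ?S. f v = r} \<subseteq> B}"
        then obtain v where "v \<in> ?S - B" "f v = r" by blast
        then have "(\<Prod>v\<in>?S - B. if f v = r then 0 else 1) = (0::'b)"
          using assms(1) by (intro prod_zero) auto
        then show "(\<Prod>v\<in>B. w (f v)) * (\<Prod>v\<in>?S - B. if f v = r then 0 else 1) = 0" by simp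
      qed
      fix B assume "B \<in> {B. B \<in> Pow ?S \<and> {v \<in> ?S. f v = r} \<subseteq> B}"
      then have "(\<Prod>v\<in>?S - B. if f v = r then 0 else 1) = (1::'b)"
        by (intro prod.neutral) auto
      then show "(\<Prod>v\<in>B. w (f v)) * (\<Prod>v\<in>?S - B. if f v = r then 0 else 1) = (\<Prod>v\<in>B. w (f v))" by simp
    qed (use assms(1) in auto)
    finally show "(\<Sum>B | B \<in> Pow ?S \<and> {v \<in> ?S. f v = r} \<subseteq> B. \<Prod>v\<in>B. w (f v)) =
        (\<Prod>v\<in>?S. w (f v) + (if f v = r then 0 else 1))" ..
  qed
  finally show ?thesis .
qed

lemma sum_shifted_weights:
  fixes w :: "'a \<Rightarrow> 'b::comm_semiring_1"
  shows "(\<Sum>v\<in>V - {r}. w v + (if v = r then 0 else 1)) = sum w (V - {r}) + of_nat (card (V - {r}))"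
proof -
  have "(\<Sum>v\<in>V - {r}. w v + (if v = r then 0 else 1)) = (\<Sum>v\<in>V - {r}. w v + 1)"
    by (rule sum.cong) auto
  then show ?thesis by (simp add: sum.distrib)
qed

theorem sum_rooted:
  fixes w :: "'a \<Rightarrow> 'b::comm_semiring_1"
  assumes "finite V" "r \<in> V"
  shows "(\<Sum>(E, D)\<in>decorated_hypertrees V r. \<Prod>e\<in>E. w (petiole V E r e)) =
           (if V = {r} then 1 else w r * (sum w V + of_nat (card V - 1)) ^ (card V - 2))"
proof -
  define y where "y v = w v + (if v = r then 0 else 1)" for v
  have y: "sum y (V - {r}) = sum w (V - {r}) + of_nat (card (V - {r}))"
    unfolding y_def by (rule sum_shifted_weights)
  have "(\<Sum>(E, D)\<in>decorated_hypertrees V r. \<Prod>e\<in>E. w (petiole V E r e)) =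
      (\<Sum>f\<in>parent_maps (V - {r}) {r}. \<Prod>v\<in>V - {r}. y (f v))"
    using sum_decorated_hypertrees[OF assms, where P = "\<lambda>_. True" and w = w] by (simp add: y_def case_prod_beta)
  also have "\<dots> = (if V - {r} = {} then 1 else
      y r * (y r + sum y (V - {r})) ^ (card (V - {r}) - 1))"
    using sum_parent_maps[of "V - {r}" "{r}" y] assms(1) by simp
  also have "y r = w r" by (simp add: y_def)
  also have "w r + sum y (V - {r}) = sum w V + of_nat (card V - 1)"
    using assms by (simp add: y sum.remove[of V r] ac_simps)
  also have "card (V - {r}) - 1 = card V - 2" using assms by simp
  also have "V - {r} = {} \<longleftrightarrow> V = {r}" using assms by blast
  finally show ?thesis .
qed

text \<open>Removing \<open>r\<close> leaves a tree rooted at its only child \<open>s\<close>. With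
  more than one vertex left, its sum is \<open>y s\<close> times a power that does not depend on
  \<open>s\<close>, and summing over \<open>s\<close> raises that power by one.\<close>

theorem sum_hollow:
  fixes w :: "'a \<Rightarrow> 'b::comm_semiring_1"
  assumes "finite V" "r \<in> V" "V \<noteq> {r}"
  shows "(\<Sum>(E, D) | (E, D) \<in> decorated_hypertrees V r \<and> card {e \<in> E. r \<in> e} = 1.
            \<Prod>e\<in>E. w (petiole V E r e)) =
           w r * (sum w (V - {r}) + of_nat (card V - 1)) ^ (card V - 2)"
proof -
  let ?S = "V - {r}"
  let ?L = "\<lambda>f. {v \<in> ?S. f v \<in> {r}}"
  let ?F = "{f \<in> parent_maps ?S {r}. card (?L f) = 1}"
  define y where "y v = w v + (if v = r then 0 else 1)" for v
  define m where "m = card ?S"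
  have fin: "finite ?S" and "?S \<noteq> {}" using assms by auto
  then have m: "m > 0" by (simp add: m_def card_gt_0_iff)
  have y: "sum y ?S = sum w ?S + of_nat (card ?S)"
    unfolding y_def by (rule sum_shifted_weights)
  have level: "(\<Sum>f | f \<in> ?F \<and> ?L f = {s}. \<Prod>v\<in>?S. y (f v)) =
      w r * (if m = 1 then 1 else y s * sum y ?S ^ (m - 2))" if s: "s \<in> ?S" for s
  proof -
    have eq: "{f. f \<in> ?F \<and> ?L f = {s}} = {f. f \<in> parent_maps ?S {r} \<and> ?L f = {s}}"
    proof -
      have "card (?L f) = 1" if "?L f = {s}" for f using that by simp
      then show ?thesis by blast
    qed
    have empty: "?S - {s} = {} \<longleftrightarrow> m = 1"
    proof -
      have "?S - {s} = {} \<longleftrightarrow> card (?S - {s}) = 0" using fin by simp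
      also have "\<dots> \<longleftrightarrow> m = 1" using s fin m by (auto simp: m_def card_Diff_singleton)
      finally show ?thesis .
    qed
    have single: "sum y {s} = y s" "sum y {r} = w r" by (simp_all add: y_def)
    have sm: "y s + sum y (?S - {s}) = sum y ?S" "card (?S - {s}) - 1 = m - 2"
      using s fin sum.remove[of ?S s y] by (simp_all add: m_def)
    have "(\<Sum>f | f \<in> parent_maps ?S {r} \<and> ?L f = {s}. \<Prod>v\<in>?S. y (f v)) =
        sum y {r} ^ card {s} * (\<Sum>f\<in>parent_maps (?S - {s}) {s}. \<Prod>v\<in>?S - {s}. y (f v))"
      by (rule sum_parent_maps_level) (use s fin in auto)
    also have "(\<Sum>f\<in>parent_maps (?S - {s}) {s}. \<Prod>v\<in>?S - {s}. y (f v)) =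
        (if ?S - {s} = {} then 1 else sum y {s} * (sum y {s} + sum y (?S - {s})) ^ (card (?S - {s}) - 1))"
      by (rule sum_parent_maps) (use fin in auto)
    finally show ?thesis
      unfolding eq empty single sm by simp
  qed
  have "(\<Sum>(E, D) | (E, D) \<in> decorated_hypertrees V r \<and> card {e \<in> E. r \<in> e} = 1.
            \<Prod>e\<in>E. w (petiole V E r e)) = (\<Sum>f\<in>?F. \<Prod>v\<in>?S. y (f v))"
    using sum_decorated_hypertrees[OF assms(1,2), where P = "\<lambda>k. k = 1" and w = w] by (simp add: y_def)
  also have "\<dots> = (\<Sum>L\<in>(\<lambda>s. {s}) ` ?S. \<Sum>f | f \<in> ?F \<and> ?L f = L. \<Prod>v\<in>?S. y (f v))"
    using fin by (intro sum.group[symmetric]) (auto simp: finite_parent_maps card_1_singleton_iff)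
  also have "\<dots> = (\<Sum>s\<in>?S. w r * (if m = 1 then 1 else y s * sum y ?S ^ (m - 2)))"
    using level by (subst sum.reindex) simp_all
  also have "\<dots> = w r * sum y ?S ^ (m - 1)"
  proof (cases "m = 1")
    case False
    then have "m - 1 = Suc (m - 2)" using m by simp
    then show ?thesis using False by (simp flip: sum_distrib_left sum_distrib_right)
  qed (simp add: m_def)
  also have "m - 1 = card V - 2"
    using assms by (simp add: m_def)
  also have "sum y ?S = sum w ?S + of_nat (card V - 1)"
    using assms by (simp add: y)
  finally show ?thesis .
qed

section \<open>The weighted series\<close>

lemma t_pow_add: "t_pow a * t_pow b = t_pow (a + b)"
  by (simp add: t_pow_def mult_single)

lemma t_pow_0 [simp]: "t_pow 0 = 1"
  by (simp add: t_pow_def flip: single_one)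

lemma t_pow_power: "t_var ^ k = t_pow (int k)"
  by (induction k) (simp_all add: t_pow_add)

text \<open>The gap is not a value of \<open>emb\<close> and gets the variable \<open>1\<close>.\<close>

definition vertex_var :: "nat \<Rightarrow> (nat \<Rightarrow> 'a) \<Rightarrow> 'a \<Rightarrow> weight_ring" where
  "vertex_var n emb v = (\<Prod>i=1..n. if v = emb i then x_var i else 1)"

lemma vertex_var_emb:
  assumes "inj_on emb {1..n}" "i \<in> {1..n}"
  shows "vertex_var n emb (emb i) = x_var i"
proof -
  have "vertex_var n emb (emb i) = (\<Prod>j=1..n. if i = j then x_var j else 1)"
    unfolding vertex_var_def using assms by (intro prod.cong) (auto dest: inj_onD)
  then show ?thesis using assms(2) by simp
qed

text \<open>Taking out \<open>1/t\<close> makes the weight multiplicative over the edges, the form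
  in which the encoding can transport it to products over marked vertices.\<close>

lemma weight_eq_prod:
  assumes "finite E"
  shows "weight n emb V E r = t_pow (- 1) * (\<Prod>e\<in>E. t_var * vertex_var n emb (petiole V E r e))"
proof -
  have "(\<Prod>e\<in>E. vertex_var n emb (petiole V E r e)) =
      (\<Prod>i=1..n. \<Prod>e\<in>E. if petiole V E r e = emb i then x_var i else 1)"
    unfolding vertex_var_def by (rule prod.swap)
  also have "\<dots> = (\<Prod>i=1..n. x_var i ^ card {e \<in> E. petiole V E r e = emb i})"
    using assms by (simp flip: prod.inter_filter)
  finally show ?thesis
    by (simp add: weight_def prod.distrib t_pow_power t_pow_add flip: mult.assoc)
qed

lemma decorated_hypertrees_finite_edges:
  assumes "(E, D) \<in> decorated_hypertrees V r"
  shows "finite E"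
proof -
  have "E \<subseteq> Pow V" "finite V"
    using assms by (auto simp: decorated_hypertrees_def hypertree_def)
  then show ?thesis using finite_subset by blast
qed

lemma rooted_total_weight_eq:
  assumes "n \<ge> 1"
  shows "rooted_total_weight n = (if n = 1 then t_pow (- 1) else
    (\<Sum>i=1..n. x_var i) * ((\<Sum>i=1..n. x_var i) * t_var + of_nat n - 1) ^ (n - 2))"
proof -
  let ?V = "{1..n}"
  let ?w = "\<lambda>v. t_var * vertex_var n (\<lambda>i. i) v"
  have w: "?w i = t_var * x_var i" if "i \<in> ?V" for i
    by (simp only: vertex_var_emb[of "\<lambda>i. i", OF _ that] inj_on_id2)
  have sum_w: "sum ?w ?V = (\<Sum>i=1..n. x_var i) * t_var"
  proof -
    have "sum ?w ?V = (\<Sum>i=1..n. t_var * x_var i)"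
      by (intro sum.cong refl) (rule w)
    then show ?thesis by (simp add: sum_distrib_left mult.commute)
  qed
  have "decorated_rooted_hypertrees ?V = (SIGMA r:?V. decorated_hypertrees ?V r)"
    by (auto simp: decorated_rooted_hypertrees_def decorated_hypertrees_def rooted_hypertree_def)
  then have "rooted_total_weight n =
      (\<Sum>r\<in>?V. \<Sum>(E, D)\<in>decorated_hypertrees ?V r. weight n (\<lambda>i. i) ?V E r)"
    by (simp add: rooted_total_weight_def sum.Sigma finite_decorated_hypertrees)
  also have "\<dots> = (\<Sum>r\<in>?V. t_pow (- 1) * (\<Sum>(E, D)\<in>decorated_hypertrees ?V r. \<Prod>e\<in>E. ?w (petiole ?V E r e)))"
    unfolding sum_distrib_left
    by (intro sum.cong refl) (auto simp: weight_eq_prod decorated_hypertrees_finite_edges)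
  also have "\<dots> = (\<Sum>r\<in>?V. t_pow (- 1) * (if ?V = {r} then 1 else
      ?w r * (sum ?w ?V + of_nat (card ?V - 1)) ^ (card ?V - 2)))"
    by (intro sum.cong refl) (subst sum_rooted, simp_all)
  also have "\<dots> = (if n = 1 then t_pow (- 1) else
    (\<Sum>i=1..n. x_var i) * ((\<Sum>i=1..n. x_var i) * t_var + of_nat n - 1) ^ (n - 2))"
  proof (cases "n = 1")
    case False
    have ne: "?V \<noteq> {r}" for r
    proof
      assume "?V = {r}"
      then have "card ?V = 1" by (metis card_1_singleton_iff One_nat_def)
      then show False using \<open>n \<noteq> 1\<close> by simp
    qed
    \<comment> \<open>The prefactor \<open>1/t\<close> cancels the \<open>t\<close> in the single
      leading factor of \<open>sum_rooted\<close>; summing over the roots then produces the sum of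
      the variables.\<close>
    have "t_pow (- 1) * ?w r = x_var r" if "r \<in> ?V" for r
      by (simp add: w[OF that] t_pow_add flip: mult.assoc)
    then have "(\<Sum>r\<in>?V. t_pow (- 1) * (if ?V = {r} then 1 else
        ?w r * (sum ?w ?V + of_nat (card ?V - 1)) ^ (card ?V - 2))) =
      (\<Sum>r\<in>?V. x_var r * (sum ?w ?V + of_nat (card ?V - 1)) ^ (card ?V - 2))"
      by (intro sum.cong refl) (simp only: ne if_False mult.assoc[symmetric])
    also have "\<dots> = (\<Sum>i=1..n. x_var i) * ((\<Sum>i=1..n. x_var i) * t_var + of_nat n - 1) ^ (n - 2)"
      unfolding sum_w using assms by (simp add: sum_distrib_right of_nat_diff add_diff_eq)
    finally show ?thesis using False by simp
  qed simp
  finally show ?thesis .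
qed

lemma ex1_iff_card: "(\<exists>!x. P x) \<longleftrightarrow> card {x. P x} = 1"
  unfolding One_nat_def card_1_singleton_iff set_eq_iff mem_Collect_eq singleton_iff by metis

lemma hollow_total_weight_eq:
  assumes "n \<ge> 1"
  shows "hollow_total_weight n = ((\<Sum>i=1..n. x_var i) * t_var + of_nat n) ^ (n - 1)"
proof -
  let ?V = "hollow_vertices {1..n}"
  let ?w = "\<lambda>v. t_var * vertex_var n Some v"
  have V: "?V - {None} = Some ` {1..n}" "finite ?V" "None \<in> ?V" "card ?V = Suc n"
    by (auto simp: hollow_vertices_def card_image)
  have ne: "?V \<noteq> {None}"
  proof
    assume "?V = {None}"
    then have "card ?V = 1" by (metis card_1_singleton_iff One_nat_def)
    then show False using V(4) assms by simp
  qed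
  have "vertex_var n Some (Some i) = x_var i" if "i \<in> {1..n}" for i
    by (rule vertex_var_emb) (use that in auto)
  then have sum_w: "sum ?w (?V - {None}) = (\<Sum>i=1..n. x_var i) * t_var"
    unfolding V(1) by (simp add: sum.reindex sum_distrib_left mult.commute)
  \<comment> \<open>The gap carries no variable, so its weight is just \<open>t\<close>. As it is an
    additional vertex, the exponent \<open>card ?V - 2\<close> equals \<open>n - 1\<close>.\<close>
  have gap: "t_pow (- 1) * ?w None = 1"
    by (simp add: vertex_var_def t_pow_add)
  have gap_edge: "(\<exists>!e. e \<in> E \<and> None \<in> e) \<longleftrightarrow> card {e \<in> E. None \<in> e} = 1" for E :: "nat option set set"
    by (rule ex1_iff_card)
  have "decorated_hollow_hypertrees {1..n} =
      {(E, D). (E, D) \<in> decorated_hypertrees ?V None \<and> card {e \<in> E. None \<in> e} = 1}"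
    unfolding decorated_hollow_hypertrees_def hollow_hypertree_def gap_edge decorated_hypertrees_def by blast
  then have "hollow_total_weight n =
      (\<Sum>(E, D) | (E, D) \<in> decorated_hypertrees ?V None \<and> card {e \<in> E. None \<in> e} = 1. weight n Some ?V E None)"
    by (simp only: hollow_total_weight_def)
  also have "\<dots> = t_pow (- 1) * (\<Sum>(E, D) | (E, D) \<in> decorated_hypertrees ?V None \<and> card {e \<in> E. None \<in> e} = 1.
      \<Prod>e\<in>E. ?w (petiole ?V E None e))"
    unfolding sum_distrib_left
    by (intro sum.cong refl) (auto simp: weight_eq_prod decorated_hypertrees_finite_edges)
  also have "\<dots> = t_pow (- 1) * (?w None * (sum ?w (?V - {None}) + of_nat (card ?V - 1)) ^ (card ?V - 2))"
    by (subst sum_hollow[OF V(2,3) ne]) simp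
  also have "\<dots> = ((\<Sum>i=1..n. x_var i) * t_var + of_nat n) ^ (n - 1)"
    using gap unfolding sum_w V(4) by (simp flip: mult.assoc)
  finally show ?thesis .
qed

text \<open>The term at 1 is set apart because the rooted hypertree without edges has weight
  \<open>1/t\<close>, outside the general formula; the hollow term there is a power with exponent
  0.\<close>

lemma exp_series_from_1:
  "exp_series_from 1 a = fps_const (a 1) * fps_X + exp_series_from 2 a"
proof (rule fps_ext)
  fix n :: nat
  have one: "const_w 1 = 1" by (simp add: const_w_def)
  consider "n = 0" | "n = 1" | "n \<ge> 2" by linarith
  then show "fps_nth (exp_series_from 1 a) n = fps_nth (fps_const (a 1) * fps_X + exp_series_from 2 a) n"
    by cases (simp_all add: exp_series_from_def one fps_X_nth)
qed

lemma exp_series_from_cong: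
  "(\<And>n. n \<ge> m \<Longrightarrow> a n = b n) \<Longrightarrow> exp_series_from m a = exp_series_from m b"
  by (auto simp: exp_series_from_def fps_eq_iff)

theorem proposition3p7:
  shows "S_hollow =
           fps_X + exp_series_from 2 (\<lambda>n.
             ((\<Sum>i=1..n. x_var i) * t_var + of_nat n) ^ (n - 1))
       \<and> S_rooted =
           fps_const (t_pow (-1)) * fps_X + exp_series_from 2 (\<lambda>n.
             (\<Sum>i=1..n. x_var i) * ((\<Sum>i=1..n. x_var i) * t_var + of_nat n - 1) ^ (n - 2))"
proof
  show "S_hollow = fps_X + exp_series_from 2 (\<lambda>n. ((\<Sum>i=1..n. x_var i) * t_var + of_nat n) ^ (n - 1))"
    unfolding S_hollow_def exp_series_from_1
    by (intro arg_cong2[of _ _ _ _ "(+)"] exp_series_from_cong)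
      (simp_all add: hollow_total_weight_eq)
  show "S_rooted = fps_const (t_pow (-1)) * fps_X + exp_series_from 2 (\<lambda>n.
      (\<Sum>i=1..n. x_var i) * ((\<Sum>i=1..n. x_var i) * t_var + of_nat n - 1) ^ (n - 2))"
    unfolding S_rooted_def exp_series_from_1
    by (intro arg_cong2[of _ _ _ _ "(+)"] exp_series_from_cong)
      (simp_all add: rooted_total_weight_eq)
qed

end
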